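(* Assume that $\varphi:\mathbb{T}\to\mathbb{R}_+$ is $2$-hyper-positive and is not identically zero. Let $N\ge1$ be an integer. Then for any Hardy function $f\in H_0^2(\mathbb{T})$ and any analytic trigonometric polynomial $B_0(e^{it})=\sum_{n=0}^{N-1}b_ne^{int}$ of degree at most $N-1$, not identically zero, we have $$\left\|\frac{E_N[H_\varphi(B_0f)]}{\sqrt{E_N[|B_0|^2\varphi]}}\right\|_{L^\infty(\mathbb{T})}\le\|f\|_{L^2(\mathbb{T};\varphi)} .$$
   Context: $\mathbb{N}=\{0,1,2,\dots\}$, $\mathbb{T}=\mathbb{R}/2\pi\mathbb{Z}$ with normalized Haar measure $m$; $\widehat{\varphi}(n)=\int_{\mathbb{T}}\varphi(e^{i\theta})e^{-in\theta}dm(\theta)$; functions on $\mathbb{T}$ are identified when equal almost everywhere. $\|f\|_{L^2(\mathbb{T};\varphi)}=\big(\int_{\mathbb{T}}|f(e^{it})|^2\varphi(e^{it})dm(t)\big)^{1/2}$. Let $\mathbb{F}_q^+$ be the unital free semigroup on generators $s_1,\dots,s_q$, with word length $|\cdot|$. A function $\alpha:\mathbb{N}\to\mathbb{C}$ is $q$-hyper-positive definite if the kernel $K$ on $\mathbb{F}_q^+$ given by $K(\sigma,\delta)=\alpha(|w|)$ if $\delta=\sigma w$ for some $w\in\mathbb{F}_q^+$, $K(\sigma,\delta)=\overline{\alpha(|w|)}$ if $\sigma=\delta w$ for some $w\in\mathbb{F}_q^+$, and $K(\sigma,\delta)=0$ otherwise, is positive definite (all matrices $[K(\sigma_i,\sigma_j)]_{i,j\le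 k}$ are non-negative definite). An integrable function $\varphi$ on $\mathbb{T}$ is $q$-hyper-positive if $\mathbb{N}\ni n\mapsto\widehat{\varphi}(n)$ is $q$-hyper-positive definite. $H^2(\mathbb{T})$ is the set of $f(e^{i\theta})=\sum_{n\ge0}a_ne^{in\theta}$ with $\sum|a_n|^2<\infty$; $H^2_0(\mathbb{T})=\{f\in H^2(\mathbb{T}):\widehat f(0)=0\}$; $H^2_-(\mathbb{T})=L^2(\mathbb{T})\ominus H_0^2(\mathbb{T})$. $R_-:L^2(\mathbb{T})\to H_-^2(\mathbb{T})$ is the orthogonal projection (keeping the Fourier modes $n\le0$). The Hankel operator is $H_\varphi(f)=R_-(\varphi f)$. The operator $E_N$ is $$E_N(g)(e^{i\theta})=\frac1N\sum_{k=0}^{N-1}g\big(e^{i\frac{\theta+2\pi k}{N}}\big),\qquad\text{characterized by }\widehat{E_N(g)}(n)=\widehat g(nN),\ n\in\mathbb{Z}.$$ *)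

theory Defs
  imports
    "HOL-Probability.Probability"
    "HOL-Library.Sublist"
    "HOL-Library.Nonpos_Ints"
begin

section \<open>Functions on the circle\<close>

text \<open>The group \<open>\<real>/2\<pi>\<int>\<close> is realised as the unit circle in the complex plane, carrying the image
  under \<open>\<theta> \<mapsto> e\<^sup>i\<^sup>\<theta>\<close> of the uniform distribution on \<open>[0,2\<pi>]\<close>.  Functions are represented by
  measurable representatives; everything below depends only on their classes modulo null sets.\<close>

definition circle :: "complex measure" where
  "circle = distr (uniform_measure lborel {0..2 * pi})
     (restrict_space borel (sphere 0 1)) cis"

lemma prob_space_circle: "prob_space circle"
proof -
  have "cis \<in> borel_measurable borel"
    by (intro borel_measurable_continuous_onI continuous_intros)
  then have "cis \<in> measurable (uniform_measure lborel {0..2 * pi}) borel"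
    by simp
  then have "cis \<in> measurable (uniform_measure lborel {0..2 * pi}) (restrict_space borel (sphere 0 1))"
    by (intro measurable_restrict_space2) auto
  then show ?thesis
    unfolding circle_def by (intro prob_space.prob_space_distr prob_space_uniform_measure) auto
qed

definition fourier_coeff :: "(complex \<Rightarrow> complex) \<Rightarrow> int \<Rightarrow> complex" where
  "fourier_coeff g n = (LINT z|circle. g z * z powi (- n))"

definition L2 :: "(complex \<Rightarrow> complex) set" where
  "L2 = {f \<in> borel_measurable circle. integrable circle (\<lambda>z. (cmod (f z))\<^sup>2)}"

definition L2_inner :: "(complex \<Rightarrow> complex) \<Rightarrow> (complex \<Rightarrow> complex) \<Rightarrow> complex" where
  "L2_inner f g = (LINT z|circle. f z * cnj (g z))"

definition weighted_L2_norm :: "(complex \<Rightarrow> real) \<Rightarrow> (complex \<Rightarrow> complex) \<Rightarrow> real" where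
  "weighted_L2_norm \<phi> f = sqrt (LINT z|circle. (cmod (f z))\<^sup>2 * \<phi> z)"

definition L2_ominus :: "(complex \<Rightarrow> complex) set \<Rightarrow> (complex \<Rightarrow> complex) set" where
  "L2_ominus V = {g \<in> L2. \<forall>u\<in>V. L2_inner g u = 0}"

section \<open>Hyper-positivity\<close>

text \<open>Elements of the free unital semigroup on \<open>q\<close> generators are the lists over \<open>{..<q}\<close>, with
  concatenation as product.\<close>

definition free_semigroup :: "nat \<Rightarrow> nat list set" where
  "free_semigroup q = lists {..<q}"

definition hyper_kernel :: "(nat \<Rightarrow> complex) \<Rightarrow> nat list \<Rightarrow> nat list \<Rightarrow> complex" where
  "hyper_kernel \<alpha> \<sigma> \<delta> =
     (if prefix \<sigma> \<delta> then \<alpha> (length \<delta> - length \<sigma>)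
      else if prefix \<delta> \<sigma> then cnj (\<alpha> (length \<sigma> - length \<delta>))
      else 0)"

text \<open>Membership of the quadratic form in \<open>\<real>\<^sub>\<ge>\<^sub>0\<close> includes that its value is real, so that the
  matrices are Hermitian.\<close>

definition positive_definite_kernel_on :: "'a set \<Rightarrow> ('a \<Rightarrow> 'a \<Rightarrow> complex) \<Rightarrow> bool" where
  "positive_definite_kernel_on X K \<longleftrightarrow>
     (\<forall>(k::nat) (x :: nat \<Rightarrow> 'a) (c :: nat \<Rightarrow> complex). (\<forall>i<k. x i \<in> X) \<longrightarrow>
        (\<Sum>i<k. \<Sum>j<k. cnj (c i) * K (x i) (x j) * c j) \<in> \<real>\<^sub>\<ge>\<^sub>0)"

definition hyper_positive_definite :: "nat \<Rightarrow> (nat \<Rightarrow> complex) \<Rightarrow> bool" where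
  "hyper_positive_definite q \<alpha> \<longleftrightarrow>
     positive_definite_kernel_on (free_semigroup q) (hyper_kernel \<alpha>)"

definition hyper_positive :: "nat \<Rightarrow> (complex \<Rightarrow> complex) \<Rightarrow> bool" where
  "hyper_positive q \<phi> \<longleftrightarrow>
     integrable circle \<phi> \<and> hyper_positive_definite q (\<lambda>n. fourier_coeff \<phi> (int n))"

section \<open>Hardy spaces and Hankel operators\<close>

text \<open>The series \<open>\<Sum>a\<^sub>n e\<^sup>i\<^sup>n\<^sup>\<theta>\<close> with square-summable coefficients is understood in the sense of
  convergence in \<open>L\<^sup>2\<close>.\<close>

definition H2 :: "(complex \<Rightarrow> complex) set" where
  "H2 = {f \<in> L2. \<exists>a :: nat \<Rightarrow> complex. summable (\<lambda>n. (cmod (a n))\<^sup>2) \<and>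
     (\<lambda>n. LINT z|circle. (cmod (f z - (\<Sum>k<n. a k * z ^ k)))\<^sup>2) \<longlonglongrightarrow> 0}"

definition H2_0 :: "(complex \<Rightarrow> complex) set" where
  "H2_0 = {f \<in> H2. fourier_coeff f 0 = 0}"

definition H2_minus :: "(complex \<Rightarrow> complex) set" where
  "H2_minus = L2_ominus H2_0"

text \<open>The orthogonal projection of \<open>L\<^sup>2\<close> onto \<open>H2_minus\<close>: some representative of the unique class
  \<open>g\<close> in that closed subspace for which \<open>h - g\<close> is orthogonal to it.  For \<open>h\<close> outside \<open>L\<^sup>2\<close> the
  value is unspecified.\<close>

definition R_minus :: "(complex \<Rightarrow> complex) \<Rightarrow> complex \<Rightarrow> complex" where
  "R_minus h = (SOME g. g \<in> H2_minus \<and> (\<lambda>z. h z - g z) \<in> L2_ominus H2_minus)"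

text \<open>Integrable 2-hyper-positive functions are essentially bounded, because their Fourier
  coefficients decay geometrically; for such \<open>\<phi>\<close> the product below stays in \<open>L\<^sup>2\<close>.\<close>

definition hankel :: "(complex \<Rightarrow> complex) \<Rightarrow> (complex \<Rightarrow> complex) \<Rightarrow> complex \<Rightarrow> complex" where
  "hankel \<phi> f = R_minus (\<lambda>z. \<phi> z * f z)"

section \<open>The averaging operators\<close>

text \<open>The argument \<open>\<theta>\<close> of a point of the circle is taken to be \<open>Arg\<close>; the lemma \<open>E_op_cis\<close> says
  that any other choice gives the same value.\<close>

definition E_op :: "nat \<Rightarrow> (complex \<Rightarrow> 'a::real_vector) \<Rightarrow> complex \<Rightarrow> 'a" where
  "E_op N g z = (1 / real N) *\<^sub>R (\<Sum>k<N. g (cis ((Arg z + 2 * pi * real k) / real N)))"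

lemma sum_roots_cis:
  assumes "N \<ge> 1"
  shows "(\<Sum>k<N. g (cis ((t + 2 * pi * real k) / real N))) = (\<Sum>w | w ^ N = cis t. g w)"
proof -
  have N: "N > 0" using assms by simp
  have c: "cis (t / N) ^ N = cis t" using N by (simp add: Complex.DeMoivre)
  have roots: "bij_betw (\<lambda>k. cis (2 * pi * real k / real N)) {..<N} {z. z ^ N = 1}"
    by (rule Complex.bij_betw_roots_unity[OF N])
  have "bij_betw (\<lambda>w. cis (t / N) * w) {w. w ^ N = 1} {w. w ^ N = cis t}"
  proof (rule bij_betwI[where g = "\<lambda>w. w / cis (t / N)"])
    show "(\<lambda>w. cis (t / N) * w) \<in> {w. w ^ N = 1} \<rightarrow> {w. w ^ N = cis t}"
      using c by (auto simp: power_mult_distrib)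
    show "(\<lambda>w. w / cis (t / N)) \<in> {w. w ^ N = cis t} \<rightarrow> {w. w ^ N = 1}"
      using c by (auto simp: power_divide)
  qed auto
  from bij_betw_trans[OF roots this]
  have "bij_betw (\<lambda>k. cis ((t + 2 * pi * real k) / real N)) {..<N} {w. w ^ N = cis t}"
    by (simp add: o_def cis_mult add_divide_distrib)
  from sum.reindex_bij_betw[OF this] show ?thesis .
qed

lemma E_op_cis:
  assumes "N \<ge> 1"
  shows "E_op N g (cis t) = (1 / real N) *\<^sub>R (\<Sum>k<N. g (cis ((t + 2 * pi * real k) / real N)))"
proof -
  have "cis (Arg (cis t)) = cis t" by (simp add: cis_Arg sgn_eq)
  then show ?thesis unfolding E_op_def by (simp add: sum_roots_cis[OF assms])
qed

end

theory Submission
  imports Defs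
begin

text \<open>Write \<open>D = E\<^sub>N[|B\<^sub>0|\<^sup>2 \<phi>]\<close>, \<open>A = E\<^sub>N[H\<^sub>\<phi>(B\<^sub>0 f)]\<close> and \<open>C = \<integral> |f|\<^sup>2 \<phi>\<close>, so that the claim is \<open>|A|\<^sup>2 \<le> C D\<close> almost
everywhere.  This says that the matrix with rows \<open>(D, A)\<close> and \<open>(cnj A, C)\<close> is nonnegative at
almost every point, and a matrix-valued symbol of this kind is nonnegative exactly when its
Toeplitz quadratic form is.  The point of the proof is that this form is a value of the
quadratic form of the tree kernel.

A positive definite kernel on words is the Gram matrix of vectors \<open>X\<^sub>w\<close>.  Two vectors have inner
product a Fourier coefficient of \<open>\<phi>\<close> when one word is a prefix of the other, and are orthogonal
otherwise.  Follow the trunk of words \<open>0\<^sup>p\<close>.  Cut it into blocks of length \<open>N\<close>, and combine the vectors in each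
block with the coefficients of \<open>B\<^sub>0\<close>: the block vectors \<open>V\<^sub>j\<close> have the Gram matrix of a stationary
sequence, with symbol \<open>D\<close>.  At the end of each block leave the trunk along the letter \<open>1\<close>, and combine the
vectors on this branch with the coefficients of \<open>f\<close>.  Words on different branches are
incomparable, hence the branch vectors \<open>W\<^sub>k\<close> are orthogonal, each of squared length \<open>C\<close>.  Finally \<open>V\<^sub>j\<close> and
\<open>W\<^sub>k\<close> are orthogonal unless block \<open>j\<close> is below the branching point of \<open>W\<^sub>k\<close>, and then their inner
product is the Fourier coefficient of \<open>\<phi> B\<^sub>0 f\<close> at a nonpositive multiple of \<open>N\<close>.  The vanishing of the other
half is what the projection in the Hankel operator does, and the multiples of \<open>N\<close> are what \<open>E\<^sub>N\<close>
keeps: the mixed Gram matrix has symbol \<open>A\<close>.  One needs a second branch at every vertex of the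
trunk, which is why \<open>2\<close>-hyper-positivity is the hypothesis.

The computation for polynomial \<open>f\<close> is \<open>tree_quadratic_inequality\<close>, and \<open>hankel_pairing_nonneg\<close> passes to
the limit.  It tests the Laurent form on \<open>g\<close> and \<open>\<mu> g\<close> for a polynomial \<open>g\<close> and a constant
\<open>\<mu>\<close>, and yields \<open>\<integral> |g|\<^sup>2 (D + 2 Re (\<mu> A) + |\<mu>|\<^sup>2 C) \<ge> 0\<close>.  By \<open>AE_nonneg_circle\<close> (Stone-Weierstrass and
inner regularity) the bracket is nonnegative almost everywhere, and letting \<open>\<mu>\<close> run through a countable
dense set gives \<open>|A|\<^sup>2 \<le> C D\<close>.

Two analytic facts make the objects meaningful.  The function \<open>\<phi>\<close> is essentially bounded
(\<open>hyper_positive_ess_bounded\<close>): comparing the root with the sum of all vertices of depth \<open>n\<close> shows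
that its Fourier coefficients decay geometrically, so its Toeplitz form is bounded by the Schur test.  And the
orthogonal projection onto the nonpositive modes exists (\<open>H2_minus_projection_exists\<close>), by the
Riesz-Fischer theorem.\<close>

section \<open>Integration on the circle\<close>

interpretation circle: prob_space circle
  by (rule prob_space_circle)

lemma space_circle [simp]: "space circle = sphere 0 1"
  by (simp add: circle_def space_restrict_space)

lemma sets_circle [measurable_cong]: "sets circle = sets (restrict_space borel (sphere 0 1))"
  by (simp add: circle_def)

lemma measurable_circle_eq: "measurable circle M = measurable (restrict_space borel (sphere 0 1)) M"
  by (rule measurable_cong_sets[OF sets_circle refl])

lemma borel_measurable_circle: "g \<in> borel_measurable borel \<Longrightarrow> g \<in> borel_measurable circle"
  unfolding measurable_circle_eq by (rule measurable_restrict_space1)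

lemma borel_measurable_circle_continuous:
  fixes g :: "complex \<Rightarrow> 'b::topological_space"
  assumes "continuous_on (sphere 0 1) g"
  shows "g \<in> borel_measurable circle"
  unfolding measurable_circle_eq by (rule borel_measurable_continuous_on_restrict[OF assms])

lemma AE_circle_norm: "AE z in circle. cmod z = 1"
  using AE_space[of circle] by simp

lemma integral_circle_cong:
  assumes "\<And>z. cmod z = 1 \<Longrightarrow> f z = g z"
  shows "(LINT z|circle. f z) = (LINT z|circle. g z)"
  by (rule Bochner_Integration.integral_cong) (use assms in auto)

lemma measurable_cis_sphere:
  assumes "sets M = sets borel"
  shows "cis \<in> measurable M (restrict_space borel (sphere 0 1))"
proof -
  have "cis \<in> borel_measurable borel"
    by (intro borel_measurable_continuous_onI continuous_intros)
  then have "cis \<in> measurable M borel"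
    unfolding measurable_cong_sets[OF assms refl] .
  then show ?thesis
    by (intro measurable_restrict_space2) auto
qed

lemma measurable_circle_cis:
  assumes "G \<in> borel_measurable circle"
  shows "(\<lambda>t. G (cis t)) \<in> borel_measurable borel"
proof (rule measurable_compose[OF measurable_cis_sphere[OF refl]])
  show "G \<in> borel_measurable (restrict_space borel (sphere 0 1))"
    using assms unfolding measurable_circle_eq .
qed

text \<open>The endpoint \<open>2\<pi>\<close> is a null set; dropping it makes \<open>N\<close> consecutive arcs of length \<open>2\<pi>/N\<close> tile the
parameter interval exactly, with no overlap to discuss later.\<close>

lemma circle_eq_distr:
  "circle = distr (density lborel (\<lambda>t. ennreal (indicator {0..<2 * pi} t / (2 * pi))))
     (restrict_space borel (sphere 0 1)) cis"
proof -
  have "uniform_measure lborel {0..2 * pi} =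
      density lborel (\<lambda>t. ennreal (indicator {0..<2 * pi} t / (2 * pi)))"
    unfolding uniform_measure_def
  proof (rule density_cong)
    have "AE t in lborel. t \<noteq> 2 * pi"
      by (rule AE_lborel_singleton)
    then show "AE t in lborel. indicator {0..2 * pi} t / emeasure lborel {0..2 * pi} =
        ennreal (indicator {0..<2 * pi} t / (2 * pi))"
      by eventually_elim
        (use divide_ennreal[of 1 "2 * pi"] in \<open>auto split: split_indicator\<close>)
  qed auto
  then show ?thesis
    unfolding circle_def by simp
qed

lemma
  fixes G :: "complex \<Rightarrow> 'b::{banach,second_countable_topology}"
  assumes G: "G \<in> borel_measurable circle"
  shows integrable_circle_iff: "integrable circle G \<longleftrightarrow>
      integrable lborel (\<lambda>t. indicator {0..<2 * pi} t *\<^sub>R G (cis t))"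
    and integral_circle: "(LINT z|circle. G z) =
      (1 / (2 * pi)) *\<^sub>R (LINT t|lborel. indicator {0..<2 * pi} t *\<^sub>R G (cis t))"
proof -
  let ?d = "\<lambda>t::real. indicator {0..<2 * pi} t / (2 * pi)"
  have G': "G \<in> borel_measurable (restrict_space borel (sphere 0 1))"
    using G unfolding measurable_circle_eq .
  have cis: "cis \<in> measurable (density lborel ?d) (restrict_space borel (sphere 0 1))"
    by (rule measurable_cis_sphere) simp
  have Gc: "(\<lambda>t. G (cis t)) \<in> borel_measurable lborel"
    using measurable_circle_cis[OF G] by simp
  have d: "?d \<in> borel_measurable lborel" "AE t in lborel. 0 \<le> ?d t"
    by auto
  have scale: "?d t *\<^sub>R G (cis t) = (1 / (2 * pi)) *\<^sub>R (indicator {0..<2 * pi} t *\<^sub>R G (cis t))" for t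
    by simp
  have scaled: "integrable lborel (\<lambda>t. (1 / (2 * pi)) *\<^sub>R h t) \<longleftrightarrow> integrable lborel h"
    for h :: "real \<Rightarrow> 'b"
    using integrable_scaleR_right[of "2 * pi" lborel "\<lambda>t. (1 / (2 * pi)) *\<^sub>R h t"] by auto
  have "integrable circle G \<longleftrightarrow> integrable lborel (\<lambda>t. ?d t *\<^sub>R G (cis t))"
    unfolding circle_eq_distr integrable_distr_eq[OF cis G'] integrable_density[OF Gc d] ..
  also have "\<dots> \<longleftrightarrow> integrable lborel (\<lambda>t. indicator {0..<2 * pi} t *\<^sub>R G (cis t))"
    unfolding scale by (rule scaled)
  finally show "integrable circle G \<longleftrightarrow>
      integrable lborel (\<lambda>t. indicator {0..<2 * pi} t *\<^sub>R G (cis t))" .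
  have "(LINT z|circle. G z) = (LINT t|lborel. ?d t *\<^sub>R G (cis t))"
    unfolding circle_eq_distr integral_distr[OF cis G'] integral_density[OF Gc d] ..
  then show "(LINT z|circle. G z) =
      (1 / (2 * pi)) *\<^sub>R (LINT t|lborel. indicator {0..<2 * pi} t *\<^sub>R G (cis t))"
    unfolding scale integral_scaleR_right .
qed

lemma integral_circle_powi: "(LINT z|circle. z powi n) = (if n = 0 then 1 else 0)"
proof (cases "n = 0")
  case False
  define F :: "real \<Rightarrow> complex" where "F t = cis (of_int n * t) / (\<i> * of_int n)" for t
  have meas: "(\<lambda>z. z powi n) \<in> borel_measurable circle"
    by (rule borel_measurable_circle_continuous) (auto intro!: continuous_intros)
  have "(LINT t|lborel. indicator {0..<2 * pi} t *\<^sub>R cis t powi n) =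
      (LINT t|lborel. indicator {0..2 * pi} t *\<^sub>R cis t powi n)"
  proof (rule integral_cong_AE)
    have "AE t in lborel. t \<noteq> 2 * pi"
      by (rule AE_lborel_singleton)
    then show "AE t in lborel. indicator {0..<2 * pi} t *\<^sub>R cis t powi n =
        indicator {0..2 * pi} t *\<^sub>R cis t powi n"
      by eventually_elim (auto split: split_indicator)
  qed (use measurable_circle_cis[OF meas] in simp_all)
  also have "\<dots> = F (2 * pi) - F 0"
  proof (rule integral_FTC_Icc)
    fix t :: real
    show "(F has_vector_derivative cis t powi n) (at t within {0..2 * pi})"
    proof -
      have "((\<lambda>t. exp (\<i> * of_int n * of_real t) / (\<i> * of_int n)) has_vector_derivative
          exp (\<i> * of_int n * of_real t)) (at t within {0..2 * pi})"
        using False by (auto intro!: derivative_eq_intros has_vector_derivative_real_field)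
      then show ?thesis
        unfolding F_def[abs_def] cis_power_int unfolding cis_conv_exp by (simp add: mult_ac)
    qed
  qed (auto intro!: continuous_intros)
  also have "\<dots> = 0"
    using cis_multiple_2pi[of "of_int n"] by (simp add: F_def mult_ac)
  finally show ?thesis
    using False integral_circle[OF meas] by simp
qed (use circle.prob_space in simp)

lemma continuous_on_circle_bounded:
  fixes g :: "complex \<Rightarrow> 'b::real_normed_vector"
  assumes "continuous_on (sphere 0 1) g"
  obtains B where "0 \<le> B" "\<And>z. cmod z = 1 \<Longrightarrow> norm (g z) \<le> B"
proof -
  have "compact (g ` sphere 0 1)"
    by (intro compact_continuous_image assms compact_sphere)
  then obtain B where "\<forall>x\<in>g ` sphere 0 1. norm x \<le> B"
    using compact_imp_bounded bounded_iff by blast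
  then have "norm (g z) \<le> \<bar>B\<bar>" if "cmod z = 1" for z
    using that by force
  then show ?thesis
    using that[of "\<bar>B\<bar>"] by simp
qed

lemma integrable_circle_mult_continuous:
  fixes g h :: "complex \<Rightarrow> 'b::{banach,second_countable_topology,real_normed_algebra}"
  assumes g: "continuous_on (sphere 0 1) g" and h: "integrable circle h"
  shows "integrable circle (\<lambda>z. g z * h z)"
proof -
  obtain B where B: "0 \<le> B" "\<And>z. cmod z = 1 \<Longrightarrow> norm (g z) \<le> B"
    using continuous_on_circle_bounded[OF g] by blast
  have [measurable]: "g \<in> borel_measurable circle" "h \<in> borel_measurable circle"
    using borel_measurable_circle_continuous[OF g] h by auto
  show ?thesis
  proof (rule Bochner_Integration.integrable_bound)
    show "integrable circle (\<lambda>z. B * norm (h z))"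
      using h by simp
    show "AE z in circle. norm (g z * h z) \<le> norm (B * norm (h z))"
      using AE_circle_norm
    proof eventually_elim
      case (elim z)
      have "norm (g z * h z) \<le> norm (g z) * norm (h z)"
        by (rule norm_mult_ineq)
      also have "\<dots> \<le> B * norm (h z)"
        by (intro mult_right_mono B elim) simp
      finally show ?case using B(1) by simp
    qed
  qed measurable
qed

section \<open>The averaging operator\<close>

text \<open>The principal argument is continuous off the nonpositive real axis, and the circle meets that
axis in one point, where the value is \<open>\<pi>\<close>.\<close>

lemma measurable_Arg_circle: "Arg \<in> borel_measurable circle"
proof -
  have "(\<lambda>z::complex. if z \<in> - \<real>\<^sub>\<le>\<^sub>0 then Arg z else pi) \<in> borel_measurable borel"
    by (rule borel_measurable_continuous_on_if) (auto intro!: continuous_intros continuous_on_Arg borel_closed)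
  then have "(\<lambda>z::complex. if z \<in> - \<real>\<^sub>\<le>\<^sub>0 then Arg z else pi) \<in> borel_measurable circle"
    by (rule borel_measurable_circle)
  moreover have eq: "(if z \<in> - \<real>\<^sub>\<le>\<^sub>0 then Arg z else pi) = Arg z" if "z \<in> space circle" for z
  proof (cases "z \<in> \<real>\<^sub>\<le>\<^sub>0")
    case True
    then have "Re z \<le> 0" "Im z = 0" "Re z \<noteq> 0"
      using that by (auto simp: complex_nonpos_Reals_iff cmod_eq_Re)
    then have "Arg z = pi"
      by (simp add: Arg_eq_pi)
    then show ?thesis by simp
  qed simp
  ultimately show ?thesis
    using measurable_cong[of circle, OF eq] by simp
qed

lemma measurable_E_op:
  fixes g :: "complex \<Rightarrow> 'b::{real_normed_vector,second_countable_topology}"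
  assumes "g \<in> borel_measurable circle"
  shows "E_op N g \<in> borel_measurable circle"
proof -
  note [measurable] = measurable_Arg_circle measurable_circle_cis[OF assms]
  have "(\<lambda>z. g (cis ((Arg z + 2 * pi * real k) / real N))) \<in> borel_measurable circle" for k
    by measurable
  then show ?thesis
    unfolding E_op_def by measurable
qed

text \<open>Substituting \<open>t = N s - 2\<pi>k\<close> turns the \<open>k\<close>-th summand of the averaging operator into an integral
over the \<open>k\<close>-th arc; these arcs tile one period.\<close>

lemma sum_indicator_consecutive_arcs:
  fixes s :: real
  assumes N: "N \<ge> 1"
  shows "(\<Sum>k<N. indicator {0..<2 * pi} (real N * s - 2 * pi * real k)) = (indicator {0..<2 * pi} s :: real)"
proof -
  have split: "(\<Sum>k<m. indicator {0..<2 * pi} (u - 2 * pi * real k)) = (indicator {0..<2 * pi * real m} u :: real)"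
    for m and u :: real
  proof (induction m)
    case (Suc m)
    define c where "c = 2 * pi * real m"
    have "0 \<le> c" by (simp add: c_def)
    have "indicator {0..<c} u + indicator {0..<p} (u - c) = (indicator {0..<c + p} u :: real)"
      if "0 \<le> p" for p
      using that \<open>0 \<le> c\<close> by (auto split: split_indicator)
    from this[of "2 * pi"] show ?case
      using Suc by (simp add: c_def algebra_simps)
  qed simp
  have "indicator {0..<2 * pi * real N} (real N * s) = (indicator {0..<2 * pi} s :: real)"
    using N by (auto simp: zero_le_mult_iff mult.commute split: split_indicator)
  then show ?thesis
    by (simp add: split)
qed

text \<open>The map \<open>w \<mapsto> w\<^sup>N\<close> preserves Haar measure, and the average over its fibres is the conditional
expectation along it, so integrals do not change.\<close>

lemma
  fixes g :: "complex \<Rightarrow> 'b::{banach,second_countable_topology}"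
  assumes N: "N \<ge> 1" and g: "integrable circle g"
  shows integrable_E_op: "integrable circle (E_op N g)"
    and integral_E_op: "(LINT z|circle. E_op N g z) = (LINT z|circle. g z)"
proof -
  define G where "G k t = indicator {0..<2 * pi} t *\<^sub>R g (cis ((t + 2 * pi * real k) / real N))" for k t
  have gm: "g \<in> borel_measurable circle"
    using g by auto
  have N0: "real N \<noteq> 0" using N by simp
  have E: "indicator {0..<2 * pi} t *\<^sub>R E_op N g (cis t) = (1 / real N) *\<^sub>R (\<Sum>k<N. G k t)" for t
    unfolding E_op_cis[OF N] G_def scaleR_sum_right[symmetric] by (simp only: scaleR_left_commute)
  have shift: "G k (- 2 * pi * real k + real N * s) =
      indicator {0..<2 * pi} (real N * s - 2 * pi * real k) *\<^sub>R (indicator {0..<2 * pi} s *\<^sub>R g (cis s))"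
    if "k < N" for k s
  proof -
    have "indicator {0..<2 * pi} (real N * s - 2 * pi * real k) \<le> (indicator {0..<2 * pi} s :: real)"
      unfolding sum_indicator_consecutive_arcs[OF N, of s, symmetric]
      by (rule member_le_sum) (use that in auto)
    then show ?thesis
      using N unfolding G_def by (auto split: split_indicator_asm split_indicator simp: algebra_simps)
  qed
  have ig: "integrable lborel (\<lambda>s. indicator {0..<2 * pi} s *\<^sub>R g (cis s))"
    using g integrable_circle_iff[OF gm] by blast
  have piece: "integrable lborel (\<lambda>s. indicator {0..<2 * pi} (real N * s - 2 * pi * real k) *\<^sub>R
      (indicator {0..<2 * pi} s *\<^sub>R g (cis s)))" for k
  proof (rule Bochner_Integration.integrable_bound[OF ig])
    show "(\<lambda>s. indicator {0..<2 * pi} (real N * s - 2 * pi * real k) *\<^sub>R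
        (indicator {0..<2 * pi} s *\<^sub>R g (cis s))) \<in> borel_measurable lborel"
      using measurable_circle_cis[OF gm] by measurable
  qed (auto split: split_indicator)
  have iG: "integrable lborel (G k)" if "k < N" for k
    using piece[of k] shift[OF that]
    by (subst lborel_integrable_real_affine_iff[OF N0, of _ "- 2 * pi * real k", symmetric]) simp
  show "integrable circle (E_op N g)"
    unfolding integrable_circle_iff[OF measurable_E_op[OF gm]] E
    using iG by (intro integrable_scaleR_right Bochner_Integration.integrable_sum) auto
  have "(LINT t|lborel. G k t) = real N *\<^sub>R (LINT s|lborel.
      indicator {0..<2 * pi} (real N * s - 2 * pi * real k) *\<^sub>R (indicator {0..<2 * pi} s *\<^sub>R g (cis s)))"
    if "k < N" for k
    using shift[OF that] by (subst lborel_integral_real_affine[OF N0, of _ "- 2 * pi * real k"]) simp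
  then have "(1 / real N) *\<^sub>R (\<Sum>k<N. LINT t|lborel. G k t) = (\<Sum>k<N. LINT s|lborel.
      indicator {0..<2 * pi} (real N * s - 2 * pi * real k) *\<^sub>R (indicator {0..<2 * pi} s *\<^sub>R g (cis s)))"
    using N0 by (simp add: scaleR_sum_right)
  also have "\<dots> = (LINT s|lborel. (\<Sum>k<N. indicator {0..<2 * pi} (real N * s - 2 * pi * real k)) *\<^sub>R
      (indicator {0..<2 * pi} s *\<^sub>R g (cis s)))"
    unfolding scaleR_sum_left by (rule Bochner_Integration.integral_sum[symmetric]) (rule piece)
  also have "\<dots> = (LINT s|lborel. indicator {0..<2 * pi} s *\<^sub>R g (cis s))"
    unfolding sum_indicator_consecutive_arcs[OF N]
    by (rule Bochner_Integration.integral_cong) (auto split: split_indicator)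
  finally show "(LINT z|circle. E_op N g z) = (LINT z|circle. g z)"
    unfolding integral_circle[OF gm] integral_circle[OF measurable_E_op[OF gm]] E using iG by simp
qed

text \<open>All points over which the average at \<open>z\<close> is taken are \<open>N\<close>-th roots of \<open>z\<close>, so \<open>p (w ^ N)\<close> is constant
there.\<close>

lemma E_op_scaleR_power:
  fixes p :: "complex \<Rightarrow> real" and g :: "complex \<Rightarrow> 'b::real_vector"
  assumes N: "N \<ge> 1" and z: "cmod z = 1"
  shows "E_op N (\<lambda>w. p (w ^ N) *\<^sub>R g w) z = p z *\<^sub>R E_op N g z"
proof -
  have "cis ((Arg z + 2 * pi * real k) / real N) ^ N = z" for k
  proof -
    have "cis ((Arg z + 2 * pi * real k) / real N) ^ N = cis (Arg z + 2 * pi * real k)"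
      using N by (simp add: Complex.DeMoivre)
    also have "\<dots> = cis (Arg z)"
      by (simp add: cis_mult[symmetric] cis_multiple_2pi)
    also have "\<dots> = z"
      using z cis_Arg[of z] by (cases "z = 0") (auto simp: sgn_eq)
    finally show ?thesis .
  qed
  then show ?thesis
    unfolding E_op_def by (simp add: scaleR_sum_right mult.commute)
qed

text \<open>This is the duality between averaging and \<open>p \<mapsto> p (w ^ N)\<close>; it replaces the description of the
averaging operator by Fourier coefficients.\<close>

lemma integral_mult_E_op:
  fixes p :: "complex \<Rightarrow> real" and g :: "complex \<Rightarrow> 'b::{banach,second_countable_topology}"
  assumes N: "N \<ge> 1" and p: "continuous_on (sphere 0 1) p" and g: "integrable circle g"
  shows "(LINT z|circle. p z *\<^sub>R E_op N g z) = (LINT w|circle. p (w ^ N) *\<^sub>R g w)"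
proof -
  have pN: "continuous_on (sphere 0 1) (\<lambda>w. p (w ^ N))"
    by (rule continuous_on_compose2[OF p]) (auto intro!: continuous_intros simp: norm_power)
  obtain B where B: "0 \<le> B" "\<And>z. cmod z = 1 \<Longrightarrow> norm (p (z ^ N)) \<le> B"
    using continuous_on_circle_bounded[OF pN] by blast
  have [measurable]: "(\<lambda>w. p (w ^ N)) \<in> borel_measurable circle" "g \<in> borel_measurable circle"
    using borel_measurable_circle_continuous[OF pN] g by auto
  have int: "integrable circle (\<lambda>w. p (w ^ N) *\<^sub>R g w)"
  proof (rule Bochner_Integration.integrable_bound)
    show "integrable circle (\<lambda>w. B *\<^sub>R g w)"
      using g by simp
    show "AE w in circle. norm (p (w ^ N) *\<^sub>R g w) \<le> norm (B *\<^sub>R g w)"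
      using AE_circle_norm by eventually_elim (use B in \<open>auto intro!: mult_right_mono\<close>)
  qed measurable
  have "(LINT z|circle. p z *\<^sub>R E_op N g z) = (LINT z|circle. E_op N (\<lambda>w. p (w ^ N) *\<^sub>R g w) z)"
    by (rule integral_circle_cong) (simp add: E_op_scaleR_power[OF N])
  also have "\<dots> = (LINT w|circle. p (w ^ N) *\<^sub>R g w)"
    by (rule integral_E_op[OF N int])
  finally show ?thesis .
qed

section \<open>Squared moduli of polynomials detect positivity\<close>

text \<open>On the circle \<open>Re z\<close> and \<open>Im z\<close> are Laurent polynomials in \<open>z\<close>, hence so is every real polynomial;
the factor \<open>z ^ m\<close> clears the negative powers.\<close>

lemma real_polynomial_function_on_circle:
  assumes "real_polynomial_function p"
  shows "\<exists>m q. \<forall>z::complex. cmod z = 1 \<longrightarrow> of_real (p z) * z ^ m = poly q z"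
  using assms
proof induction
  case (linear f)
  interpret bounded_linear f by fact
  have "of_real (f z) * z ^ 1 = poly [: of_real ((f 1) / 2) + \<i> * of_real (f \<i> / 2), 0, of_real (f 1 / 2) - \<i> * of_real (f \<i> / 2) :] z"
    if "cmod z = 1" for z
  proof -
    have "f z = f (Re z *\<^sub>R 1 + Im z *\<^sub>R \<i>)"
      by (simp add: complex_eq[symmetric] scaleR_conv_of_real mult.commute)
    also have "\<dots> = Re z * f 1 + Im z * f \<i>"
      by (simp only: add scaleR real_scaleR_def)
    finally have f: "f z = Re z * f 1 + Im z * f \<i>" .
    have "z * cnj z = 1"
      using that by (simp add: complex_norm_square[symmetric])
    then have "of_real (Re z) * z = (1 + z\<^sup>2) / 2" "of_real (Im z) * z = \<i> * (1 - z\<^sup>2) / 2"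
      by (simp_all add: complex_eq_iff power2_eq_square algebra_simps)
    moreover have "of_real (f z) * z ^ 1 =
        of_real (f 1) * (of_real (Re z) * z) + of_real (f \<i>) * (of_real (Im z) * z)"
      by (simp add: f algebra_simps)
    ultimately have "of_real (f z) * z ^ 1 =
        of_real (f 1) * ((1 + z\<^sup>2) / 2) + of_real (f \<i>) * (\<i> * (1 - z\<^sup>2) / 2)"
      by (simp only:)
    then show ?thesis
      by (simp add: field_simps power2_eq_square)
  qed
  then show ?case by blast
next
  case (const c)
  have "of_real c * z ^ 0 = poly [:of_real c:] z" for z :: complex by simp
  then show ?case by blast
next
  case (add f g)
  then obtain m q n r where
    "\<And>z::complex. cmod z = 1 \<Longrightarrow> of_real (f z) * z ^ m = poly q z"
    "\<And>z::complex. cmod z = 1 \<Longrightarrow> of_real (g z) * z ^ n = poly r z"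
    by auto
  moreover have "of_real (f z + g z) * z ^ (m + n) =
      (of_real (f z) * z ^ m) * z ^ n + (of_real (g z) * z ^ n) * z ^ m" for z :: complex
    by (simp add: algebra_simps power_add)
  ultimately have "of_real (f z + g z) * z ^ (m + n) = poly (q * monom 1 n + r * monom 1 m) z"
    if "cmod z = 1" for z
    using that by (simp add: poly_monom)
  then show ?case by blast
next
  case (mult f g)
  then obtain m q n r where
    "\<And>z::complex. cmod z = 1 \<Longrightarrow> of_real (f z) * z ^ m = poly q z"
    "\<And>z::complex. cmod z = 1 \<Longrightarrow> of_real (g z) * z ^ n = poly r z"
    by auto
  moreover have "of_real (f z * g z) * z ^ (m + n) =
      (of_real (f z) * z ^ m) * (of_real (g z) * z ^ n)" for z :: complex
    by (simp add: power_add mult_ac)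
  ultimately have "of_real (f z * g z) * z ^ (m + n) = poly (q * r) z" if "cmod z = 1" for z
    using that by (simp only: poly_mult)
  then show ?case by blast
qed

text \<open>The factor \<open>z ^ m\<close> of the previous lemma has modulus one, so it is invisible in \<open>cmod (poly q z)\<close>.\<close>

lemma approx_by_cmod_poly:
  fixes h :: "complex \<Rightarrow> real"
  assumes h: "continuous_on (sphere 0 1) h" "\<And>z. cmod z = 1 \<Longrightarrow> 0 \<le> h z" and e: "0 < e"
  obtains q where "\<And>z. cmod z = 1 \<Longrightarrow> \<bar>h z - cmod (poly q z)\<bar> < e"
proof -
  obtain p where p: "real_polynomial_function p" "\<And>z. z \<in> sphere 0 1 \<Longrightarrow> \<bar>h z - p z\<bar> < e"
    using Stone_Weierstrass_real_polynomial_function[OF compact_sphere h(1) e] by blast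
  obtain m q where q: "\<And>z::complex. cmod z = 1 \<Longrightarrow> of_real (p z) * z ^ m = poly q z"
    using real_polynomial_function_on_circle[OF p(1)] by blast
  have "\<bar>h z - cmod (poly q z)\<bar> < e" if "cmod z = 1" for z
  proof -
    have "cmod (poly q z) = \<bar>p z\<bar>"
      using that by (simp flip: q[OF that] add: norm_mult norm_power)
    then show ?thesis
      using p(2)[of z] h(2)[OF that] that by simp
  qed
  then show ?thesis by (rule that)
qed

text \<open>The indicator of \<open>K\<close> is a bounded pointwise limit of squared moduli of polynomials: squeeze
continuous bumps onto \<open>K\<close> and approximate each by the modulus of a polynomial.\<close>

lemma set_integral_compact_nonneg:
  fixes \<psi> :: "complex \<Rightarrow> real"
  assumes int: "integrable circle \<psi>"
    and pos: "\<And>q. 0 \<le> (LINT z|circle. (cmod (poly q z))\<^sup>2 * \<psi> z)"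
    and K: "compact K" "K \<noteq> {}"
  shows "0 \<le> (LINT z|circle. indicator K z * \<psi> z)"
proof -
  define h where "h n z = max 0 (1 - real n * infdist z K)" for n :: nat and z :: complex
  have "\<exists>q. \<forall>z. cmod z = 1 \<longrightarrow> \<bar>h n z - cmod (poly q z)\<bar> < inverse (real (Suc n))" for n
  proof -
    have "continuous_on (sphere 0 1) (h n)"
      unfolding h_def by (intro continuous_intros)
    from approx_by_cmod_poly[OF this, of "inverse (real (Suc n))"] show ?thesis
      by (auto simp: h_def)
  qed
  then obtain q where q: "\<And>n z. cmod z = 1 \<Longrightarrow> \<bar>h n z - cmod (poly (q n) z)\<bar> < inverse (real (Suc n))"
    by metis
  have h01: "0 \<le> h n z" "h n z \<le> 1" for n z
    by (auto simp: h_def infdist_nonneg)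
  have lim_h: "(\<lambda>n. h n z) \<longlonglongrightarrow> indicator K z" for z
  proof (cases "z \<in> K")
    case False
    have d: "infdist z K > 0"
      using False K by (simp add: infdist_pos_not_in_closed compact_imp_closed)
    obtain n0 where n0: "1 / infdist z K < real n0"
      using reals_Archimedean2 by blast
    have "eventually (\<lambda>n. h n z = 0) sequentially"
      using eventually_ge_at_top[of n0]
    proof eventually_elim
      case (elim n)
      then have "1 / infdist z K < real n" using n0 by linarith
      then show ?case using d by (simp add: h_def field_simps)
    qed
    then show ?thesis using False by (simp add: tendsto_eventually)
  qed (simp add: h_def)
  have lim: "(\<lambda>n. cmod (poly (q n) z)) \<longlonglongrightarrow> indicator K z" if "cmod z = 1" for z
  proof -
    have "(\<lambda>n. cmod (poly (q n) z) - h n z) \<longlonglongrightarrow> 0"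
    proof (rule Lim_null_comparison)
      show "\<forall>\<^sub>F n in sequentially. norm (cmod (poly (q n) z) - h n z) \<le> inverse (real (Suc n))"
        using q[OF that] by (auto simp: abs_minus_commute less_imp_le)
    qed (rule LIMSEQ_inverse_real_of_nat)
    from tendsto_add[OF this lim_h[of z]] show ?thesis by simp
  qed
  have K_meas [measurable]: "K \<in> sets borel"
    using K by (simp add: compact_imp_closed borel_closed)
  note [measurable] = int[THEN borel_measurable_integrable]
  have [measurable]: "poly (q n) \<in> borel_measurable circle" for n
    by (intro borel_measurable_circle_continuous continuous_intros)
  have [measurable]: "(\<lambda>z. indicator K z :: real) \<in> borel_measurable circle"
    by (rule borel_measurable_circle) simp
  have "(\<lambda>n. LINT z|circle. (cmod (poly (q n) z))\<^sup>2 * \<psi> z) \<longlonglongrightarrow> (LINT z|circle. indicator K z * \<psi> z)"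
  proof (rule integral_dominated_convergence)
    show "integrable circle (\<lambda>z. 4 * \<bar>\<psi> z\<bar>)"
      using int by simp
    show "AE z in circle. (\<lambda>n. (cmod (poly (q n) z))\<^sup>2 * \<psi> z) \<longlonglongrightarrow> indicator K z * \<psi> z"
      using AE_circle_norm
    proof eventually_elim
      case (elim z)
      have "(\<lambda>n. (cmod (poly (q n) z))\<^sup>2 * \<psi> z) \<longlonglongrightarrow> (indicator K z)\<^sup>2 * \<psi> z"
        by (intro tendsto_intros lim elim)
      then show ?case by (simp add: power2_eq_square split: split_indicator_asm)
    qed
    show "AE z in circle. norm ((cmod (poly (q n) z))\<^sup>2 * \<psi> z) \<le> 4 * \<bar>\<psi> z\<bar>" for n
      using AE_circle_norm
    proof eventually_elim
      case (elim z)
      have "inverse (real (Suc n)) \<le> 1" by (simp add: field_simps)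
      then have "cmod (poly (q n) z) \<le> 2"
        using q[OF elim, of n] h01[of n z] by linarith
      then have "(cmod (poly (q n) z))\<^sup>2 \<le> 2\<^sup>2"
        by (intro power_mono) auto
      then show ?case by (auto simp: abs_mult intro!: mult_right_mono)
    qed
  qed measurable
  then show ?thesis
    by (rule LIMSEQ_le_const) (use pos in auto)
qed

text \<open>If \<open>\<psi>\<close> were negative on a set of positive measure, it would be negative on a compact subset of
positive measure, by inner regularity, and have a negative integral there.\<close>

lemma AE_nonneg_circle:
  fixes \<psi> :: "complex \<Rightarrow> real"
  assumes int: "integrable circle \<psi>"
    and pos: "\<And>q. 0 \<le> (LINT z|circle. (cmod (poly q z))\<^sup>2 * \<psi> z)"
  shows "AE z in circle. 0 \<le> \<psi> z"
proof -
  note [measurable] = int[THEN borel_measurable_integrable]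
  define S where "S = {z \<in> space circle. \<psi> z < 0}"
  have S: "S \<in> sets circle"
    unfolding S_def by measurable
  have S_borel: "S \<in> sets borel"
    using S by (auto simp: sets_circle sets_restrict_space_iff)
  have id: "(\<lambda>z. z) \<in> measurable circle borel"
    by (rule borel_measurable_circle) simp
  \<comment> \<open>Regularity is available for measures on the Borel sets of the whole plane.\<close>
  define M where "M = distr circle borel (\<lambda>z. z)"
  have M: "emeasure M A = emeasure circle (A \<inter> sphere 0 1)" if "A \<in> sets borel" for A
    unfolding M_def using that by (subst emeasure_distr[OF id]) (auto simp: Int_commute)
  have null: "emeasure M K = 0" if K: "K \<subseteq> S" "compact K" for K
  proof (cases "K = {}")
    case False
    have Kb: "K \<in> sets borel"
      using K by (simp add: compact_imp_closed borel_closed)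
    have KS: "K \<inter> sphere 0 1 = K"
      using K by (auto simp: S_def)
    have Kc: "K \<in> sets circle"
      using Kb K by (auto simp: sets_circle sets_restrict_space_iff S_def)
    have iK: "integrable circle (\<lambda>z. indicator K z * \<psi> z)"
      using integrable_mult_indicator[OF Kc int] by simp
    have "0 \<le> (LINT z|circle. indicator K z * \<psi> z)"
      by (rule set_integral_compact_nonneg[OF int pos K(2) False])
    moreover have nonpos: "indicator K z * \<psi> z \<le> 0" for z
      using K by (auto simp: S_def split: split_indicator)
    then have "0 \<le> (LINT z|circle. - (indicator K z * \<psi> z))"
      by (intro Bochner_Integration.integral_nonneg) auto
    ultimately have "(LINT z|circle. - (indicator K z * \<psi> z)) = 0"
      by simp
    then have "AE z in circle. - (indicator K z * \<psi> z) = 0"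
      using integral_nonneg_eq_0_iff_AE[of circle "\<lambda>z. - (indicator K z * \<psi> z)"] iK nonpos by simp
    then have "AE z in circle. z \<notin> K"
      by eventually_elim (use K in \<open>auto simp: S_def split: split_indicator_asm\<close>)
    moreover have "{z \<in> space circle. \<not> z \<notin> K} = K"
      using KS by auto
    ultimately have "emeasure circle K = 0"
      using Kc AE_iff_measurable[of K circle "\<lambda>z. z \<notin> K"] by blast
    then show ?thesis
      using M[OF Kb] KS by simp
  qed simp
  have "emeasure M S = (SUP K \<in> {K. K \<subseteq> S \<and> compact K}. emeasure M K)"
  proof (rule inner_regular)
    show "emeasure M (space M) \<noteq> \<infinity>"
      using circle.emeasure_finite M[of UNIV] by (simp add: M_def)
  qed (simp_all add: M_def S_borel)
  also have "\<dots> = 0"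
    using null by (auto intro!: antisym SUP_least)
  finally have "emeasure circle S = 0"
    using M[OF S_borel] by (simp add: S_def Int_absorb2 subset_eq)
  then show ?thesis
    using S AE_iff_measurable[of S circle "\<lambda>z. 0 \<le> \<psi> z"] by (auto simp: S_def not_le)
qed

section \<open>Toeplitz forms, the tree kernel and boundedness\<close>

lemma continuous_on_circle_powi [continuous_intros]: "continuous_on (sphere 0 1) (\<lambda>z::complex. z powi n)"
  by (auto intro!: continuous_intros)

lemma cnj_circle: "cmod z = 1 \<Longrightarrow> cnj z = inverse z"
  using complex_norm_square[of z] by (intro inverse_unique[symmetric]) simp

lemma cnj_powi_circle: "cmod z = 1 \<Longrightarrow> cnj (z powi n) = z powi (- n)"
  by (simp add: cnj_circle power_int_inverse power_int_minus)

lemma cnj_fourier_coeff: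
  "cnj (fourier_coeff (\<lambda>z. complex_of_real (\<phi> z)) n) = fourier_coeff (\<lambda>z. complex_of_real (\<phi> z)) (- n)"
  unfolding fourier_coeff_def
  unfolding Bochner_Integration.integral_cnj[symmetric]
  by (rule integral_circle_cong) (simp add: cnj_circle power_int_inverse power_int_minus)

lemma cmod_sum_powi_square:
  fixes e :: "'i \<Rightarrow> int"
  assumes "cmod z = 1"
  shows "complex_of_real ((cmod (\<Sum>i\<in>A. x i * z powi (- e i)))\<^sup>2) =
    (\<Sum>i\<in>A. \<Sum>j\<in>A. cnj (x i) * x j * z powi (e i - e j))"
proof -
  have "z \<noteq> 0" using assms by auto
  then have "cnj (x i * z powi (- e i)) * (x j * z powi (- e j)) = cnj (x i) * x j * z powi (e i - e j)" for i j
    using assms by (simp add: cnj_circle power_int_inverse power_int_diff power_int_minus field_simps)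
  note prod = this
  have "complex_of_real ((cmod (\<Sum>i\<in>A. x i * z powi (- e i)))\<^sup>2) =
      cnj (\<Sum>i\<in>A. x i * z powi (- e i)) * (\<Sum>i\<in>A. x i * z powi (- e i))"
    unfolding complex_norm_square by (rule mult.commute)
  then show ?thesis
    unfolding cnj_sum sum_product prod .
qed

text \<open>The exponents \<open>e\<close> are arbitrary because the trunk of the tree will be indexed backwards, and a branch
starts at the index \<open>1\<close>.\<close>

lemma toeplitz_form_eq_integral:
  fixes \<phi> :: "complex \<Rightarrow> real" and e :: "'i \<Rightarrow> int"
  assumes \<phi>: "integrable circle \<phi>"
  shows "(\<Sum>i\<in>A. \<Sum>j\<in>A. cnj (x i) * fourier_coeff (\<lambda>z. complex_of_real (\<phi> z)) (e j - e i) * x j) =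
    complex_of_real (LINT z|circle. (cmod (\<Sum>i\<in>A. x i * z powi (- e i)))\<^sup>2 * \<phi> z)"
proof -
  have int: "integrable circle (\<lambda>z. z powi n * complex_of_real (\<phi> z))" for n
    by (rule integrable_circle_mult_continuous) (use \<phi> in \<open>auto intro: continuous_intros\<close>)
  have "complex_of_real (LINT z|circle. (cmod (\<Sum>i\<in>A. x i * z powi (- e i)))\<^sup>2 * \<phi> z) =
      (LINT z|circle. complex_of_real ((cmod (\<Sum>i\<in>A. x i * z powi (- e i)))\<^sup>2) * complex_of_real (\<phi> z))"
    by (simp flip: integral_complex_of_real)
  also have "\<dots> = (LINT z|circle. (\<Sum>i\<in>A. \<Sum>j\<in>A. cnj (x i) * x j * (z powi (e i - e j) * complex_of_real (\<phi> z))))"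
    by (rule integral_circle_cong, subst cmod_sum_powi_square) (simp_all add: sum_distrib_left sum_distrib_right mult_ac)
  also have "\<dots> = (\<Sum>i\<in>A. \<Sum>j\<in>A. cnj (x i) * x j * (LINT z|circle. z powi (e i - e j) * complex_of_real (\<phi> z)))"
    using int by (subst Bochner_Integration.integral_sum; simp)+
  also have "\<dots> = (\<Sum>i\<in>A. \<Sum>j\<in>A. cnj (x i) * fourier_coeff (\<lambda>z. complex_of_real (\<phi> z)) (e j - e i) * x j)"
    by (simp add: fourier_coeff_def mult_ac)
  finally show ?thesis ..
qed

lemma fourier_coeff_one: "fourier_coeff (\<lambda>z. complex_of_real 1) n = (if n = 0 then 1 else 0)"
  by (simp add: fourier_coeff_def integral_circle_powi)

lemma integral_cmod_powi_sum_square: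
  assumes "inj_on e A" "finite A"
  shows "(LINT z|circle. (cmod (\<Sum>i\<in>A. x i * z powi (- e i)))\<^sup>2) = (\<Sum>i\<in>A. (cmod (x i))\<^sup>2)"
proof -
  have "complex_of_real (LINT z|circle. (cmod (\<Sum>i\<in>A. x i * z powi (- e i)))\<^sup>2 * 1) =
      (\<Sum>i\<in>A. \<Sum>j\<in>A. cnj (x i) * fourier_coeff (\<lambda>z. complex_of_real 1) (e j - e i) * x j)"
    using toeplitz_form_eq_integral[of "\<lambda>_. 1" x e A] by simp
  also have "\<dots> = (\<Sum>i\<in>A. \<Sum>j\<in>A. if i = j then cnj (x i) * x j else 0)"
    unfolding fourier_coeff_one using assms(1) by (intro sum.cong) (auto simp: inj_on_def)
  also have "\<dots> = (\<Sum>i\<in>A. complex_of_real ((cmod (x i))\<^sup>2))"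
    using assms(2) by (simp add: sum.delta complex_norm_square mult.commute del: of_real_power)
  finally show ?thesis
    by (simp flip: of_real_sum of_real_power add: of_real_eq_iff)
qed

text \<open>Any finite index set may replace the initial segment of the definition; the points \<open>w i\<close> may
repeat.\<close>

lemma positive_definite_kernel_onD:
  assumes K: "positive_definite_kernel_on X K" and S: "finite S" and w: "\<And>i. i \<in> S \<Longrightarrow> w i \<in> X"
  shows "(\<Sum>i\<in>S. \<Sum>j\<in>S. cnj (x i) * K (w i) (w j) * x j) \<in> \<real>\<^sub>\<ge>\<^sub>0"
proof -
  obtain h where h: "bij_betw h {..<card S} S"
    using ex_bij_betw_nat_finite[OF S] by (auto simp: atLeast0LessThan)
  then have "h i \<in> S" if "i < card S" for i
    using that by (auto simp: bij_betw_def)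
  then have "(\<Sum>i<card S. \<Sum>j<card S. cnj (x (h i)) * K (w (h i)) (w (h j)) * x (h j)) \<in> \<real>\<^sub>\<ge>\<^sub>0"
    using K[unfolded positive_definite_kernel_on_def, rule_format, of "card S" "w \<circ> h" "x \<circ> h"] w by simp
  then show ?thesis
    by (simp add: sum.reindex_bij_betw[OF h, of "\<lambda>j. cnj (x _) * K (w _) (w j) * x j"]
        sum.reindex_bij_betw[OF h, of "\<lambda>i. \<Sum>j\<in>S. cnj (x i) * K (w i) (w j) * x j"])
qed

text \<open>For real \<open>\<phi>\<close> conjugating a coefficient reverses its index, so both cases of the kernel are the
coefficient at the signed difference of lengths.\<close>

lemma hyper_kernel_fourier_coeff:
  "hyper_kernel (\<lambda>n. fourier_coeff (\<lambda>z. complex_of_real (\<phi> z)) (int n)) \<sigma> \<delta> =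
    (if prefix \<sigma> \<delta> \<or> prefix \<delta> \<sigma>
     then fourier_coeff (\<lambda>z. complex_of_real (\<phi> z)) (int (length \<delta>) - int (length \<sigma>)) else 0)"
  using prefix_length_le[of \<sigma> \<delta>] prefix_length_le[of \<delta> \<sigma>]
  by (cases "prefix \<sigma> \<delta>"; cases "prefix \<delta> \<sigma>")
    (simp_all add: hyper_kernel_def cnj_fourier_coeff of_nat_diff)

lemma hyper_positive_form_nonneg:
  fixes \<phi> :: "complex \<Rightarrow> real"
  assumes "hyper_positive q (\<lambda>z. complex_of_real (\<phi> z))" "finite S" "\<And>i. i \<in> S \<Longrightarrow> w i \<in> lists {..<q}"
  shows "(\<Sum>i\<in>S. \<Sum>j\<in>S. cnj (x i) * (if prefix (w i) (w j) \<or> prefix (w j) (w i)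
     then fourier_coeff (\<lambda>z. complex_of_real (\<phi> z)) (int (length (w j)) - int (length (w i))) else 0) * x j) \<in> \<real>\<^sub>\<ge>\<^sub>0"
proof -
  have "positive_definite_kernel_on (lists {..<q})
      (hyper_kernel (\<lambda>n. fourier_coeff (\<lambda>z. complex_of_real (\<phi> z)) (int n)))"
    using assms(1) by (simp add: hyper_positive_def hyper_positive_definite_def free_semigroup_def)
  from positive_definite_kernel_onD[OF this assms(2), of w x] assms(3) show ?thesis
    unfolding hyper_kernel_fourier_coeff .
qed

lemma fourier_coeff_zero_eq_integral:
  fixes \<phi> :: "complex \<Rightarrow> real"
  shows "fourier_coeff (\<lambda>z. complex_of_real (\<phi> z)) 0 = complex_of_real (LINT z|circle. \<phi> z)"
  by (simp add: fourier_coeff_def)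

text \<open>Test the kernel on the root and the \<open>q\<^sup>n\<close> words of length \<open>n\<close>.  The latter are orthogonal, so their sum
has squared length \<open>q\<^sup>n c\<^sub>0\<close> while its inner product with the root is \<open>q\<^sup>n c\<^sub>n\<close>; Cauchy-Schwarz gives
\<open>q\<^sup>n |c\<^sub>n| \<le> c\<^sub>0 q\<^bsup>n/2\<^esup>\<close>.\<close>

lemma hyper_positive_coeff_decay:
  fixes \<phi> :: "complex \<Rightarrow> real"
  assumes \<phi>: "hyper_positive q (\<lambda>z. complex_of_real (\<phi> z))" and q: "q \<ge> 1" and n: "n \<ge> 1"
  shows "cmod (fourier_coeff (\<lambda>z. complex_of_real (\<phi> z)) (int n)) \<le> (LINT z|circle. \<phi> z) * (1 / sqrt q) ^ n"
proof -
  define c where "c = fourier_coeff (\<lambda>z. complex_of_real (\<phi> z))"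
  define W where "W = {w \<in> lists {..<q}. length w = n}"
  define m where "m = real q ^ n"
  \<comment> \<open>The weight that attains equality in Cauchy-Schwarz: it aligns the phases and balances the lengths.\<close>
  define s where "s = - cnj (sgn (c n)) / sqrt m"
  define x where "x w = (if w = [] then 1 else s)" for w :: "nat list"
  let ?K = "\<lambda>v w. if prefix v w \<or> prefix w v then c (int (length w) - int (length v)) else 0"
  have W: "finite W" "card W = q ^ n" "[] \<notin> W"
    using n card_lists_length_eq[of "{..<q}" n] finite_lists_length_eq[of "{..<q}" n]
    by (auto simp: W_def lists_eq_set conj_commute)
  have m: "m > 0" "real (card W) = m" using q by (auto simp: m_def W)
  have prefix_W: "v = w" if "prefix v w" "v \<in> W" "w \<in> W" for v w
    using prefixE[OF that(1)] that(2,3) unfolding W_def by fastforce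
  have KW: "?K v w = (if v = w then c 0 else 0)" if "v \<in> W" "w \<in> W" for v w
    using prefix_W[of v w] prefix_W[of w v] that by auto
  have "(\<Sum>v\<in>insert [] W. \<Sum>w\<in>insert [] W. cnj (x v) * ?K v w * x w) \<in> \<real>\<^sub>\<ge>\<^sub>0"
    unfolding c_def
  proof (rule hyper_positive_form_nonneg[OF \<phi>, where w = "\<lambda>w. w"])
    show "finite (insert [] W)" using W(1) by simp
    show "v \<in> lists {..<q}" if "v \<in> insert [] W" for v
      using that by (auto simp: W_def)
  qed
  also have "(\<Sum>v\<in>insert [] W. \<Sum>w\<in>insert [] W. cnj (x v) * ?K v w * x w) =
      c 0 + (\<Sum>w\<in>W. c n * s) + (\<Sum>v\<in>W. cnj s * c (- int n) + (\<Sum>w\<in>W. if v = w then cnj s * c 0 * s else 0))"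
  proof -
    have "(\<Sum>w\<in>W. cnj (x []) * ?K [] w * x w) = (\<Sum>w\<in>W. c n * s)"
      using n by (intro sum.cong) (auto simp: x_def W_def)
    moreover have "(\<Sum>w\<in>insert [] W. cnj (x v) * ?K v w * x w) =
        cnj s * c (- int n) + (\<Sum>w\<in>W. if v = w then cnj s * c 0 * s else 0)" if v: "v \<in> W" for v
    proof -
      have "(\<Sum>w\<in>W. cnj (x v) * ?K v w * x w) = (\<Sum>w\<in>W. if v = w then cnj s * c 0 * s else 0)"
        using W(3) v by (intro sum.cong refl, subst KW) (auto simp: x_def)
      then show ?thesis
        using W v by (auto simp: x_def W_def)
    qed
    ultimately show ?thesis
      using W by (simp add: x_def)
  qed
  also have "\<dots> = c 0 + m * (c n * s + cnj (c n * s)) + m * complex_of_real ((cmod s)\<^sup>2) * c 0"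
  proof -
    have "of_nat (card W) = complex_of_real m"
      using m(2) by (metis of_real_of_nat_eq)
    then show ?thesis
      using W(1) by (simp add: sum.distrib complex_norm_square c_def cnj_fourier_coeff algebra_simps del: of_real_power)
  qed
  also have "\<dots> = complex_of_real ((LINT z|circle. \<phi> z) + 2 * m * Re (c n * s) + m * (cmod s)\<^sup>2 * (LINT z|circle. \<phi> z))"
    unfolding complex_add_cnj by (simp add: c_def fourier_coeff_zero_eq_integral)
  finally have ineq: "0 \<le> (LINT z|circle. \<phi> z) + 2 * m * Re (c n * s) + m * (cmod s)\<^sup>2 * (LINT z|circle. \<phi> z)"
    by (simp only: nonneg_Reals_of_real_iff)
  show ?thesis
  proof (cases "c n = 0")
    case False
    have "c n * s = complex_of_real (- (cmod (c n) / sqrt m))"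
      using False by (simp add: s_def sgn_eq complex_norm_square[symmetric] field_simps power2_eq_square)
    then have Re_cs: "Re (c n * s) = - (cmod (c n) / sqrt m)"
      by (simp only: Re_complex_of_real)
    have "(cmod s)\<^sup>2 = 1 / m"
      using False m by (simp add: s_def norm_divide norm_sgn power_divide)
    then have "m * (cmod s)\<^sup>2 * (LINT z|circle. \<phi> z) = (LINT z|circle. \<phi> z)"
      using m by simp
    moreover have "2 * m * Re (c n * s) = - 2 * (sqrt m * cmod (c n))"
      unfolding Re_cs using real_div_sqrt[of m] m by (simp add: field_simps)
    ultimately have "sqrt m * cmod (c n) \<le> (LINT z|circle. \<phi> z)"
      using ineq by linarith
    then have "cmod (c n) \<le> (LINT z|circle. \<phi> z) / sqrt m"
      using m by (simp add: field_simps)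
    also have "sqrt m = sqrt q ^ n"
      by (simp add: m_def real_sqrt_power)
    finally show ?thesis
      by (simp add: c_def power_divide)
  next
    case True
    have "[] \<in> lists {..<q}" by simp
    then have "c 0 \<in> \<real>\<^sub>\<ge>\<^sub>0"
      using hyper_positive_form_nonneg[OF \<phi>, of "{[]}" "\<lambda>w. w" "\<lambda>_. 1"] by (simp add: c_def)
    then have "0 \<le> (LINT z|circle. \<phi> z)"
      by (simp add: c_def fourier_coeff_zero_eq_integral)
    then show ?thesis
      using True by (simp add: c_def)
  qed
qed

text \<open>A row of the matrix has entries summing to at most two geometric series, one on either side of the
diagonal.\<close>

lemma schur_test_geometric:
  fixes c :: "int \<Rightarrow> complex" and x :: "nat \<Rightarrow> complex"
  assumes c: "\<And>n. cmod (c n) \<le> C * r ^ nat \<bar>n\<bar>" and r: "0 \<le> r" "r < 1" and C: "0 \<le> C"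
  shows "cmod (\<Sum>i\<le>d. \<Sum>j\<le>d. cnj (x i) * c (int i - int j) * x j) \<le> 2 * C / (1 - r) * (\<Sum>i\<le>d. (cmod (x i))\<^sup>2)"
proof -
  have geom: "(\<Sum>k\<le>m. r ^ k) \<le> 1 / (1 - r)" for m
    using sum_le_suminf[of "\<lambda>k. r ^ k" "{..m}"] r suminf_geometric[of r] by simp
  have row: "(\<Sum>j\<le>d. C * r ^ nat \<bar>int i - int j\<bar>) \<le> 2 * C / (1 - r)" if i: "i \<le> d" for i
  proof -
    have "(\<Sum>j\<le>d. r ^ nat \<bar>int i - int j\<bar>) \<le> (\<Sum>j\<le>i. r ^ nat \<bar>int i - int j\<bar>) + (\<Sum>j\<in>{i..d}. r ^ nat \<bar>int i - int j\<bar>)"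
    proof -
      let ?g = "\<lambda>j. r ^ nat \<bar>int i - int j\<bar>"
      have "{..d} = {..i} \<union> {i..d}" using i by auto
      moreover have "sum ?g ({..i} \<union> {i..d}) + sum ?g ({..i} \<inter> {i..d}) = sum ?g {..i} + sum ?g {i..d}"
        by (rule sum.union_inter) auto
      moreover have "0 \<le> sum ?g ({..i} \<inter> {i..d})"
        using r by (intro sum_nonneg) simp
      ultimately show ?thesis by simp
    qed
    also have "(\<Sum>j\<le>i. r ^ nat \<bar>int i - int j\<bar>) = (\<Sum>k\<le>i. r ^ k)"
      by (rule sum.reindex_bij_witness[of _ "\<lambda>k. i - k" "\<lambda>j. i - j"]) (auto simp: nat_minus_as_int)
    also have "(\<Sum>j\<in>{i..d}. r ^ nat \<bar>int i - int j\<bar>) = (\<Sum>k\<le>d - i. r ^ k)"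
      by (rule sum.reindex_bij_witness[of _ "\<lambda>k. i + k" "\<lambda>j. j - i"]) (use i in \<open>auto simp: nat_minus_as_int\<close>)
    finally have "(\<Sum>j\<le>d. r ^ nat \<bar>int i - int j\<bar>) \<le> 2 * (1 / (1 - r))"
      using geom[of i] geom[of "d - i"] by linarith
    from mult_left_mono[OF this C] show ?thesis
      by (simp add: sum_distrib_left mult_ac)
  qed
  have "cmod (\<Sum>i\<le>d. \<Sum>j\<le>d. cnj (x i) * c (int i - int j) * x j) \<le>
      (\<Sum>i\<le>d. \<Sum>j\<le>d. cmod (cnj (x i) * c (int i - int j) * x j))"
    by (intro order_trans[OF norm_sum] sum_mono order_refl)
  also have "\<dots> \<le> (\<Sum>i\<le>d. \<Sum>j\<le>d. C * r ^ nat \<bar>int i - int j\<bar> * ((cmod (x i))\<^sup>2 / 2 + (cmod (x j))\<^sup>2 / 2))"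
  proof (intro sum_mono)
    fix i j
    have "cmod (cnj (x i) * c (int i - int j) * x j) = cmod (c (int i - int j)) * (cmod (x i) * cmod (x j))"
      by (simp add: norm_mult)
    also have "\<dots> \<le> (C * r ^ nat \<bar>int i - int j\<bar>) * ((cmod (x i))\<^sup>2 / 2 + (cmod (x j))\<^sup>2 / 2)"
      using c[of "int i - int j"] sum_squares_bound[of "cmod (x i)" "cmod (x j)"] r C
      by (intro mult_mono) auto
    finally show "cmod (cnj (x i) * c (int i - int j) * x j) \<le>
        C * r ^ nat \<bar>int i - int j\<bar> * ((cmod (x i))\<^sup>2 / 2 + (cmod (x j))\<^sup>2 / 2)" .
  qed
  also have "\<dots> = (\<Sum>i\<le>d. (\<Sum>j\<le>d. C * r ^ nat \<bar>int i - int j\<bar>) * (cmod (x i))\<^sup>2)"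
  proof -
    define w where "w i j = C * r ^ nat \<bar>int i - int j\<bar>" for i j :: nat
    have sym: "w i j = w j i" for i j
      unfolding w_def by (subst abs_minus_commute) (rule refl)
    have "(\<Sum>i\<le>d. \<Sum>j\<le>d. w i j * ((cmod (x j))\<^sup>2 / 2)) = (\<Sum>i\<le>d. \<Sum>j\<le>d. w i j * ((cmod (x i))\<^sup>2 / 2))"
      by (subst sum.swap, subst sym) (rule refl)
    then have "(\<Sum>i\<le>d. \<Sum>j\<le>d. w i j * ((cmod (x i))\<^sup>2 / 2 + (cmod (x j))\<^sup>2 / 2)) =
        (\<Sum>i\<le>d. (\<Sum>j\<le>d. w i j * ((cmod (x i))\<^sup>2 / 2)) + (\<Sum>j\<le>d. w i j * ((cmod (x i))\<^sup>2 / 2)))"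
      by (simp only: distrib_left sum.distrib)
    also have "\<dots> = (\<Sum>i\<le>d. (\<Sum>j\<le>d. w i j) * (cmod (x i))\<^sup>2)"
      unfolding sum_distrib_right[symmetric] by (intro sum.cong refl) simp
    finally show ?thesis
      unfolding w_def .
  qed
  also have "\<dots> \<le> (\<Sum>i\<le>d. 2 * C / (1 - r) * (cmod (x i))\<^sup>2)"
    by (intro sum_mono mult_right_mono row) auto
  finally show ?thesis
    by (simp add: sum_distrib_left)
qed

text \<open>With \<open>M\<close> the Schur bound, the Toeplitz form of \<open>M - \<phi>\<close> is nonnegative, so \<open>M - \<phi>\<close> is nonnegative by
\<open>AE_nonneg_circle\<close>.\<close>

lemma hyper_positive_ess_bounded:
  fixes \<phi> :: "complex \<Rightarrow> real"
  assumes \<phi>: "hyper_positive q (\<lambda>z. complex_of_real (\<phi> z))" and q: "q \<ge> 2"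
  shows "\<exists>M\<ge>0. AE z in circle. \<phi> z \<le> M"
proof -
  define c where "c = fourier_coeff (\<lambda>z. complex_of_real (\<phi> z))"
  define C where "C = (LINT z|circle. \<phi> z)"
  define r where "r = 1 / sqrt (real q)"
  have int: "integrable circle \<phi>"
    using \<phi> by (simp add: hyper_positive_def complex_of_real_integrable_eq)
  have r: "0 \<le> r" "r < 1"
    using q by (auto simp: r_def)
  have c_pos: "cmod (c (int n)) \<le> C * r ^ n" if "n \<ge> 1" for n
    using hyper_positive_coeff_decay[OF \<phi> _ that] q by (simp add: c_def C_def r_def)
  have "0 \<le> C * r ^ 1"
    by (rule order_trans[OF norm_ge_zero c_pos]) simp
  then have C: "0 \<le> C"
    using q by (simp add: r_def zero_le_divide_iff)
  have c_bound: "cmod (c n) \<le> C * r ^ nat \<bar>n\<bar>" for n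
  proof -
    consider "n = 0" | "n \<ge> 1" | "n \<le> -1" by linarith
    then show ?thesis
    proof cases
      case 1
      then show ?thesis
        using C by (simp add: c_def fourier_coeff_zero_eq_integral C_def)
    next
      case 2
      then show ?thesis
        using c_pos[of "nat n"] by simp
    next
      case 3
      have "cmod (c n) = cmod (cnj (c (- n)))"
        by (simp add: c_def cnj_fourier_coeff)
      then show ?thesis
        using c_pos[of "nat (- n)"] 3 by simp
    qed
  qed
  define M where "M = 2 * C / (1 - r)"
  have "AE z in circle. 0 \<le> M - \<phi> z"
  proof (rule AE_nonneg_circle)
    show "integrable circle (\<lambda>z. M - \<phi> z)"
      using int by simp
    fix p :: "complex poly"
    have poly: "poly p z = (\<Sum>i\<le>degree p. coeff p i * z powi (- (- int i)))" for z
      by (simp add: poly_altdef)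
    have cont: "continuous_on (sphere 0 1) (\<lambda>z. (cmod (poly p z))\<^sup>2)"
      by (intro continuous_intros)
    have "complex_of_real (LINT z|circle. (cmod (poly p z))\<^sup>2 * \<phi> z) =
        (\<Sum>i\<le>degree p. \<Sum>j\<le>degree p. cnj (coeff p i) * c (int i - int j) * coeff p j)"
      unfolding poly c_def
      by (subst toeplitz_form_eq_integral[OF int, symmetric]) simp
    from arg_cong[OF this, of cmod] have "\<bar>LINT z|circle. (cmod (poly p z))\<^sup>2 * \<phi> z\<bar> =
        cmod (\<Sum>i\<le>degree p. \<Sum>j\<le>degree p. cnj (coeff p i) * c (int i - int j) * coeff p j)"
      unfolding norm_of_real .
    also have "\<dots> \<le> M * (\<Sum>i\<le>degree p. (cmod (coeff p i))\<^sup>2)"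
      unfolding M_def by (rule schur_test_geometric[OF c_bound r C])
    also have "(\<Sum>i\<le>degree p. (cmod (coeff p i))\<^sup>2) = (LINT z|circle. (cmod (poly p z))\<^sup>2)"
      unfolding poly by (rule integral_cmod_powi_sum_square[symmetric]) (auto simp: inj_on_def)
    finally have "(LINT z|circle. (cmod (poly p z))\<^sup>2 * \<phi> z) \<le> (LINT z|circle. (cmod (poly p z))\<^sup>2 * M)"
      by (simp add: mult.commute)
    moreover have "integrable circle (\<lambda>z. (cmod (poly p z))\<^sup>2 * g z)" if "integrable circle g" for g :: "complex \<Rightarrow> real"
      by (rule integrable_circle_mult_continuous[OF cont that])
    from this[OF int] this[of "\<lambda>_. M"] have "(LINT z|circle. (cmod (poly p z))\<^sup>2 * (M - \<phi> z)) =
        (LINT z|circle. (cmod (poly p z))\<^sup>2 * M) - (LINT z|circle. (cmod (poly p z))\<^sup>2 * \<phi> z)"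
      unfolding right_diff_distrib by (intro Bochner_Integration.integral_diff) simp_all
    ultimately show "0 \<le> (LINT z|circle. (cmod (poly p z))\<^sup>2 * (M - \<phi> z))"
      by simp
  qed
  then show ?thesis
    using C r by (intro exI[of _ M]) (auto simp: M_def)
qed

section \<open>Square-integrable functions and the Riesz-Fischer theorem\<close>

lemma L2_mult_integrable:
  assumes "f \<in> L2" "g \<in> L2"
  shows "integrable circle (\<lambda>z. f z * g z)"
proof (rule Bochner_Integration.integrable_bound)
  show "integrable circle (\<lambda>z. (cmod (f z))\<^sup>2 + (cmod (g z))\<^sup>2)"
    using assms by (simp add: L2_def)
  have [measurable]: "f \<in> borel_measurable circle" "g \<in> borel_measurable circle"
    using assms by (simp_all add: L2_def)
  show "(\<lambda>z. f z * g z) \<in> borel_measurable circle"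
    by measurable
  have "cmod (f z * g z) \<le> (cmod (f z))\<^sup>2 + (cmod (g z))\<^sup>2" for z
  proof -
    have "0 \<le> cmod (f z) * cmod (g z)" by simp
    then show ?thesis
      using sum_squares_bound[of "cmod (f z)" "cmod (g z)"] unfolding norm_mult by linarith
  qed
  then show "AE z in circle. norm (f z * g z) \<le> norm ((cmod (f z))\<^sup>2 + (cmod (g z))\<^sup>2)"
    by simp
qed

lemma L2_cnj: "f \<in> L2 \<Longrightarrow> (\<lambda>z. cnj (f z)) \<in> L2"
  using measurable_compose[of f circle borel cnj borel]
  by (simp add: L2_def borel_measurable_continuous_onI continuous_on_cnj)

lemma L2_add:
  assumes "f \<in> L2" "g \<in> L2"
  shows "(\<lambda>z. f z + g z) \<in> L2"
proof -
  have [measurable]: "f \<in> borel_measurable circle" "g \<in> borel_measurable circle"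
    using assms by (simp_all add: L2_def)
  have "integrable circle (\<lambda>z. (cmod (f z + g z))\<^sup>2)"
  proof (rule Bochner_Integration.integrable_bound)
    show "integrable circle (\<lambda>z. 2 * (cmod (f z))\<^sup>2 + 2 * (cmod (g z))\<^sup>2)"
      using assms by (simp add: L2_def)
    have "(cmod (f z + g z))\<^sup>2 \<le> 2 * (cmod (f z))\<^sup>2 + 2 * (cmod (g z))\<^sup>2" for z
    proof -
      have "(cmod (f z + g z))\<^sup>2 \<le> (cmod (f z) + cmod (g z))\<^sup>2"
        by (intro power_mono norm_triangle_ineq) simp
      also have "\<dots> \<le> 2 * (cmod (f z))\<^sup>2 + 2 * (cmod (g z))\<^sup>2"
        using sum_squares_bound[of "cmod (f z)" "cmod (g z)"] by (simp add: power2_sum)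
      finally show ?thesis .
    qed
    then show "AE z in circle. norm ((cmod (f z + g z))\<^sup>2) \<le> norm (2 * (cmod (f z))\<^sup>2 + 2 * (cmod (g z))\<^sup>2)"
      by simp
  qed measurable
  then show ?thesis by (simp add: L2_def)
qed

lemma L2_bounded_mult:
  assumes u: "u \<in> borel_measurable circle" "AE z in circle. cmod (u z) \<le> B" and f: "f \<in> L2"
  shows "(\<lambda>z. u z * f z) \<in> L2"
proof -
  have [measurable]: "f \<in> borel_measurable circle" "u \<in> borel_measurable circle"
    using assms by (simp_all add: L2_def)
  have "integrable circle (\<lambda>z. (cmod (u z * f z))\<^sup>2)"
  proof (rule Bochner_Integration.integrable_bound)
    show "integrable circle (\<lambda>z. B\<^sup>2 * (cmod (f z))\<^sup>2)"
      using f by (simp add: L2_def)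
    show "AE z in circle. norm ((cmod (u z * f z))\<^sup>2) \<le> norm (B\<^sup>2 * (cmod (f z))\<^sup>2)"
      using u(2) by eventually_elim (auto simp: norm_mult power_mult_distrib intro!: mult_right_mono power_mono)
  qed measurable
  then show ?thesis by (simp add: L2_def)
qed

lemma L2_const_mult: "f \<in> L2 \<Longrightarrow> (\<lambda>z. c * f z) \<in> L2"
  by (rule L2_bounded_mult[of _ "cmod c"]) auto

lemma L2_diff: "f \<in> L2 \<Longrightarrow> g \<in> L2 \<Longrightarrow> (\<lambda>z. f z - g z) \<in> L2"
  using L2_add[of f "\<lambda>z. - 1 * g z"] L2_const_mult[of g "- 1"] by simp

lemma L2_continuous:
  assumes "continuous_on (sphere 0 1) f"
  shows "f \<in> L2"
  using assms
  by (auto simp: L2_def borel_measurable_circle_continuous intro!: continuous_intros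
      integrable_circle_mult_continuous[of "\<lambda>z. (cmod (f z))\<^sup>2" "\<lambda>_. 1", simplified])

text \<open>Cauchy-Schwarz in the form in which it is used, through the weighted inequality
\<open>|u v| \<le> t |u|\<^sup>2 + |v|\<^sup>2 / t\<close>.\<close>

lemma L2_integral_mult_tendsto_0:
  assumes u: "u \<in> L2" and v: "\<And>n. v n \<in> L2"
    and lim: "(\<lambda>n. LINT z|circle. (cmod (v n z))\<^sup>2) \<longlonglongrightarrow> 0"
  shows "(\<lambda>n. LINT z|circle. u z * v n z) \<longlonglongrightarrow> 0"
proof (rule LIMSEQ_I)
  fix e :: real
  assume e: "0 < e"
  define U where "U = (LINT z|circle. (cmod (u z))\<^sup>2) + 1"
  have U: "(LINT z|circle. (cmod (u z))\<^sup>2) \<le> U" "U > 0"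
    using Bochner_Integration.integral_nonneg[of circle "\<lambda>z. (cmod (u z))\<^sup>2"] by (simp_all add: U_def add_nonneg_pos)
  define t where "t = e / (2 * U)"
  have t: "t > 0" using e U by (simp add: t_def)
  have bound: "cmod (LINT z|circle. u z * v n z) \<le> t * U + (LINT z|circle. (cmod (v n z))\<^sup>2) / t" for n
  proof -
    have "cmod (u z * v n z) \<le> t * (cmod (u z))\<^sup>2 + (cmod (v n z))\<^sup>2 / t" for z
    proof -
      have "2 * (t * cmod (u z)) * cmod (v n z) \<le> (t * cmod (u z))\<^sup>2 + (cmod (v n z))\<^sup>2"
        by (rule sum_squares_bound)
      moreover have "0 \<le> t * cmod (u z) * cmod (v n z)" using t by simp
      ultimately have "t * cmod (u z) * cmod (v n z) \<le> (t * cmod (u z))\<^sup>2 + (cmod (v n z))\<^sup>2"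
        by linarith
      then show ?thesis
        using t by (simp add: norm_mult field_simps power2_eq_square)
    qed
    moreover have "integrable circle (\<lambda>z. t * (cmod (u z))\<^sup>2)" "integrable circle (\<lambda>z. (cmod (v n z))\<^sup>2 / t)"
      using u v[of n] by (simp_all add: L2_def)
    ultimately have "cmod (LINT z|circle. u z * v n z) \<le> (LINT z|circle. t * (cmod (u z))\<^sup>2 + (cmod (v n z))\<^sup>2 / t)"
      by (intro Bochner_Integration.integral_norm_bound_integral[OF L2_mult_integrable[OF u v]]) auto
    also have "\<dots> = t * (LINT z|circle. (cmod (u z))\<^sup>2) + (LINT z|circle. (cmod (v n z))\<^sup>2) / t"
      using u v[of n] by (simp add: L2_def)
    also have "\<dots> \<le> t * U + (LINT z|circle. (cmod (v n z))\<^sup>2) / t"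
      using U t by simp
    finally show ?thesis .
  qed
  have "0 < e * t / 2" using e t by simp
  from LIMSEQ_D[OF lim this] obtain n0 where n0: "\<And>n. n \<ge> n0 \<Longrightarrow> \<bar>LINT z|circle. (cmod (v n z))\<^sup>2\<bar> < e * t / 2"
    by auto
  have "cmod (LINT z|circle. u z * v n z) < e" if "n \<ge> n0" for n
  proof -
    have "(LINT z|circle. (cmod (v n z))\<^sup>2) / t < e / 2"
      using n0[OF that] t by (simp add: field_simps)
    moreover have "t * U = e / 2"
      using U by (simp add: t_def)
    ultimately show ?thesis
      using bound[of n] by linarith
  qed
  then show "\<exists>n0. \<forall>n\<ge>n0. norm ((LINT z|circle. u z * v n z) - 0) < e"
    by auto
qed

lemma integral_cmod_partial_sum_square:
  assumes "finite A"
  shows "(LINT z|circle. (cmod (\<Sum>k\<in>A. a k * z ^ k))\<^sup>2) = (\<Sum>k\<in>A. (cmod (a k))\<^sup>2)"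
  using integral_cmod_powi_sum_square[of "\<lambda>k. - int k" A a] assms by (simp add: inj_on_def)

text \<open>The norms in \<open>L\<^sup>2\<close> are at most \<open>2\<^bsup>-k\<^esup>\<close>, so the norms in \<open>L\<^sup>1\<close> are summable.\<close>

lemma AE_summable_of_geometric_L2_bounds:
  fixes d :: "nat \<Rightarrow> complex \<Rightarrow> complex"
  assumes d: "\<And>k. d k \<in> L2" and bound: "\<And>k. (LINT z|circle. (cmod (d k z))\<^sup>2) \<le> (1 / 4) ^ k"
  shows "AE z in circle. summable (\<lambda>k. cmod (d k z))"
proof -
  have [measurable]: "d k \<in> borel_measurable circle" for k
    using d by (simp add: L2_def)
  have le: "(\<integral>\<^sup>+z. ennreal (cmod (d k z)) \<partial>circle) \<le> ennreal (2 * (1 / 2) ^ k)" for k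
  proof -
    \<comment> \<open>Splitting with weight \<open>2\<^sup>k\<close> balances the two terms, since the integral of the square is at most \<open>4\<^bsup>-k\<^esup>\<close>.\<close>
    have pt: "cmod (d k z) \<le> (1 / 2) ^ k + 2 ^ k * (cmod (d k z))\<^sup>2" for z
    proof -
      define t :: real where "t = 2 ^ k"
      have t: "t > 0" "(1 / 2) ^ k = 1 / t" by (simp_all add: t_def power_divide)
      have "2 * (t * cmod (d k z)) * 1 \<le> (t * cmod (d k z))\<^sup>2 + 1\<^sup>2"
        by (rule sum_squares_bound)
      moreover have "0 \<le> t * cmod (d k z)" using t by simp
      ultimately have "t * cmod (d k z) \<le> (t * cmod (d k z))\<^sup>2 + 1"
        unfolding one_power2 by linarith
      then show ?thesis
        using t by (simp add: t_def[symmetric] field_simps power2_eq_square)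
    qed
    have int: "integrable circle (\<lambda>z. (1 / 2) ^ k + 2 ^ k * (cmod (d k z))\<^sup>2)"
      using d[of k] by (simp add: L2_def)
    have "(\<integral>\<^sup>+z. ennreal (cmod (d k z)) \<partial>circle) \<le> (\<integral>\<^sup>+z. ennreal ((1 / 2) ^ k + 2 ^ k * (cmod (d k z))\<^sup>2) \<partial>circle)"
      by (intro nn_integral_mono ennreal_leI pt)
    also have "\<dots> = ennreal (LINT z|circle. (1 / 2) ^ k + 2 ^ k * (cmod (d k z))\<^sup>2)"
      by (rule nn_integral_eq_integral[OF int]) simp
    also have "(LINT z|circle. (1 / 2) ^ k + 2 ^ k * (cmod (d k z))\<^sup>2) =
        (1 / 2) ^ k + 2 ^ k * (LINT z|circle. (cmod (d k z))\<^sup>2)"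
      using d[of k] circle.prob_space by (simp add: L2_def)
    also have "\<dots> \<le> (1 / 2) ^ k + 2 ^ k * (1 / 4) ^ k"
      by (intro add_left_mono mult_left_mono bound) simp
    also have "\<dots> = 2 * (1 / 2) ^ k"
      by (simp flip: power_mult_distrib)
    finally show ?thesis by (simp add: ennreal_leI)
  qed
  have "(\<integral>\<^sup>+z. (\<Sum>k. ennreal (cmod (d k z))) \<partial>circle) = (\<Sum>k. \<integral>\<^sup>+z. ennreal (cmod (d k z)) \<partial>circle)"
    by (rule nn_integral_suminf) measurable
  also have "\<dots> \<le> (\<Sum>k. ennreal (2 * (1 / 2) ^ k))"
    by (intro suminf_le le) auto
  also have "\<dots> = ennreal (\<Sum>k. 2 * (1 / 2) ^ k)"
    by (rule suminf_ennreal2) (auto intro!: summable_mult summable_geometric)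
  finally have "(\<integral>\<^sup>+z. (\<Sum>k. ennreal (cmod (d k z))) \<partial>circle) \<noteq> \<infinity>"
    by (auto simp: top_unique)
  then have "AE z in circle. (\<Sum>k. ennreal (cmod (d k z))) \<noteq> \<infinity>"
    by (intro nn_integral_noteq_infinite) auto
  then show ?thesis
    by eventually_elim (auto intro!: summable_suminf_not_top)
qed

text \<open>Partial sums along a sparse sequence converge almost everywhere, because the blocks between them are
geometrically small; Fatou's lemma then bounds the distance of the limit to every partial sum by
the tail of the series.\<close>

lemma riesz_fischer_circle:
  fixes a :: "nat \<Rightarrow> complex"
  assumes a: "summable (\<lambda>k. (cmod (a k))\<^sup>2)"
  obtains u where "u \<in> L2" "(\<lambda>m. LINT z|circle. (cmod (u z - (\<Sum>k<m. a k * z ^ k)))\<^sup>2) \<longlonglongrightarrow> 0"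
proof -
  define S where "S m z = (\<Sum>k<m. a k * z ^ k)" for m z
  define tail where "tail m = (\<Sum>k. (cmod (a (k + m)))\<^sup>2)" for m
  have S_L2: "S m \<in> L2" for m
    unfolding S_def by (intro L2_continuous continuous_intros)
  have [measurable]: "S m \<in> borel_measurable circle" for m
    using S_L2[of m] by (simp add: L2_def)
  have tail_lim: "tail \<longlonglongrightarrow> 0"
    unfolding tail_def by (rule suminf_exist_split2[OF a])
  have diff: "(LINT z|circle. (cmod (S n z - S m z))\<^sup>2) \<le> tail m" if "m \<le> n" for m n
  proof -
    have "S n z - S m z = (\<Sum>k\<in>{m..<n}. a k * z ^ k)" for z
      unfolding S_def using that by (subst sum_diff[symmetric]) (auto intro!: sum.cong)
    then have "(LINT z|circle. (cmod (S n z - S m z))\<^sup>2) = (\<Sum>k\<in>{m..<n}. (cmod (a k))\<^sup>2)"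
      by (simp add: integral_cmod_partial_sum_square)
    also have "\<dots> = (\<Sum>k<n - m. (cmod (a (k + m)))\<^sup>2)"
      using that by (intro sum.reindex_bij_witness[of _ "\<lambda>k. k + m" "\<lambda>k. k - m"]) auto
    also have "\<dots> \<le> tail m"
      unfolding tail_def by (intro sum_le_suminf summable_ignore_initial_segment a) auto
    finally show ?thesis .
  qed
  have "\<exists>n. \<forall>m\<ge>n. tail m \<le> (1 / 4) ^ k" for k
  proof -
    have "(0::real) < (1 / 4) ^ k" by simp
    from LIMSEQ_D[OF tail_lim this] obtain n0 where "\<forall>m\<ge>n0. \<bar>tail m\<bar> < (1 / 4) ^ k"
      by auto
    then have "\<forall>m\<ge>n0. tail m \<le> (1 / 4) ^ k"
      by (meson abs_le_D1 less_imp_le)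
    then show ?thesis ..
  qed
  then obtain n where n: "\<And>k m. n k \<le> m \<Longrightarrow> tail m \<le> (1 / 4) ^ k"
    by metis
  \<comment> \<open>Increasing, beyond \<open>n k\<close> for the bound on the block, and beyond \<open>k\<close> so that Fatou can be applied to every partial sum.\<close>
  define R where "R k = k + (\<Sum>i\<le>k. n i)" for k
  have R: "R k \<le> R (Suc k)" "k \<le> R k" "n k \<le> R k" for k
    by (auto simp: R_def intro: trans_le_add2 member_le_sum)
  define d where "d k z = S (R (Suc k)) z - S (R k) z" for k z
  have "AE z in circle. summable (\<lambda>k. cmod (d k z))"
  proof (rule AE_summable_of_geometric_L2_bounds)
    show "d k \<in> L2" for k
      unfolding d_def by (intro L2_diff S_L2)
    show "(LINT z|circle. (cmod (d k z))\<^sup>2) \<le> (1 / 4) ^ k" for k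
      unfolding d_def using diff[OF R(1)] n[OF R(3)] by (rule order_trans)
  qed
  then have conv: "AE z in circle. convergent (\<lambda>k. S (R k) z)"
  proof eventually_elim
    case (elim z)
    have "(\<Sum>k<m. d k z) = S (R m) z - S (R 0) z" for m
      unfolding d_def by (rule sum_lessThan_telescope)
    then have "(\<lambda>m. S (R m) z) = (\<lambda>m. S (R 0) z + (\<Sum>k<m. d k z))"
      by auto
    moreover have "convergent (\<lambda>m. \<Sum>k<m. d k z)"
      using summable_norm_cancel[OF elim] by (simp add: summable_iff_convergent)
    ultimately show ?case
      by (simp add: convergent_add_const_iff)
  qed
  define u where "u z = lim (\<lambda>k. S (R k) z)" for z
  have u_meas [measurable]: "u \<in> borel_measurable circle"
    unfolding u_def by (rule borel_measurable_lim_metric) measurable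
  have lim_u: "AE z in circle. (\<lambda>k. S (R k) z) \<longlonglongrightarrow> u z"
    using conv by eventually_elim (simp add: u_def convergent_LIMSEQ_iff)
  have fatou: "(\<integral>\<^sup>+z. ennreal ((cmod (u z - S m z))\<^sup>2) \<partial>circle) \<le> ennreal (tail m)" for m
  proof -
    have "(\<integral>\<^sup>+z. ennreal ((cmod (u z - S m z))\<^sup>2) \<partial>circle) =
        (\<integral>\<^sup>+z. liminf (\<lambda>k. ennreal ((cmod (S (R k) z - S m z))\<^sup>2)) \<partial>circle)"
    proof (rule nn_integral_cong_AE)
      show "AE z in circle. ennreal ((cmod (u z - S m z))\<^sup>2) = liminf (\<lambda>k. ennreal ((cmod (S (R k) z - S m z))\<^sup>2))"
        using lim_u
      proof eventually_elim
        case (elim z)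
        have "(\<lambda>k. ennreal ((cmod (S (R k) z - S m z))\<^sup>2)) \<longlonglongrightarrow> ennreal ((cmod (u z - S m z))\<^sup>2)"
          by (intro tendsto_intros elim)
        then show ?case
          by (intro lim_imp_Liminf[symmetric]) auto
      qed
    qed
    also have "\<dots> \<le> liminf (\<lambda>k. \<integral>\<^sup>+z. ennreal ((cmod (S (R k) z - S m z))\<^sup>2) \<partial>circle)"
      by (rule nn_integral_liminf) measurable
    also have "\<dots> \<le> ennreal (tail m)"
    proof (rule Liminf_le)
      show "\<forall>\<^sub>F k in sequentially. (\<integral>\<^sup>+z. ennreal ((cmod (S (R k) z - S m z))\<^sup>2) \<partial>circle) \<le> ennreal (tail m)"
        using eventually_ge_at_top[of m]
      proof eventually_elim
        case (elim k)
        have "integrable circle (\<lambda>z. (cmod (S (R k) z - S m z))\<^sup>2)"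
          using L2_diff[OF S_L2[of "R k"] S_L2[of m]] by (simp add: L2_def)
        then have "(\<integral>\<^sup>+z. ennreal ((cmod (S (R k) z - S m z))\<^sup>2) \<partial>circle) =
            ennreal (LINT z|circle. (cmod (S (R k) z - S m z))\<^sup>2)"
          by (intro nn_integral_eq_integral) auto
        also have "\<dots> \<le> ennreal (tail m)"
          using diff[OF order_trans[OF elim R(2)]] by (rule ennreal_leI)
        finally show ?case .
      qed
    qed simp
    finally show ?thesis .
  qed
  have tail0: "0 \<le> tail m" for m
    unfolding tail_def by (intro suminf_nonneg summable_ignore_initial_segment a) simp
  have int: "integrable circle (\<lambda>z. (cmod (u z - S m z))\<^sup>2)" for m
  proof (rule integrableI_bounded)
    show "(\<integral>\<^sup>+z. ennreal (norm ((cmod (u z - S m z))\<^sup>2)) \<partial>circle) < \<infinity>"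
      using fatou[of m] by (auto intro: le_less_trans)
  qed measurable
  have le: "(LINT z|circle. (cmod (u z - S m z))\<^sup>2) \<le> tail m" for m
    using fatou[of m] tail0[of m] by (simp add: nn_integral_eq_integral[OF int])
  show ?thesis
  proof
    show "u \<in> L2"
      using int[of 0] by (simp add: L2_def S_def)
    show "(\<lambda>m. LINT z|circle. (cmod (u z - (\<Sum>k<m. a k * z ^ k)))\<^sup>2) \<longlonglongrightarrow> 0"
      by (rule tendsto_sandwich[OF _ _ tendsto_const tail_lim]) (use le in \<open>auto simp: S_def\<close>)
  qed
qed

section \<open>Hardy functions and the projection onto the nonpositive modes\<close>

lemma integral_sum_power_mult_powi:
  assumes "finite A"
  shows "(LINT z|circle. (\<Sum>k\<in>A. a k * z ^ k) * z powi n) = (\<Sum>k\<in>A. if int k = - n then a k else 0)"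
proof -
  have "(LINT z|circle. (\<Sum>k\<in>A. a k * z ^ k) * z powi n) = (LINT z|circle. (\<Sum>k\<in>A. a k * z powi (int k + n)))"
  proof (rule integral_circle_cong)
    fix z :: complex
    assume "cmod z = 1"
    then have "z \<noteq> 0" by auto
    then show "(\<Sum>k\<in>A. a k * z ^ k) * z powi n = (\<Sum>k\<in>A. a k * z powi (int k + n))"
      by (simp add: power_int_add sum_distrib_left mult_ac)
  qed
  also have "\<dots> = (\<Sum>k\<in>A. LINT z|circle. a k * z powi (int k + n))"
  proof (rule Bochner_Integration.integral_sum)
    show "integrable circle (\<lambda>z. a k * z powi (int k + n))" for k
      using integrable_circle_mult_continuous[OF continuous_on_mult_left[OF continuous_on_circle_powi], of "\<lambda>_. 1"]
      by simp
  qed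
  also have "\<dots> = (\<Sum>k\<in>A. if int k = - n then a k else 0)"
    by (intro sum.cong refl) (auto simp: integral_circle_powi)
  finally show ?thesis .
qed

lemma L2_powi: "(\<lambda>z. z powi n) \<in> L2"
  by (intro L2_continuous continuous_intros)

lemma L2_partial_sum: "(\<lambda>z. \<Sum>k\<in>A. a k * z ^ k) \<in> L2"
  by (intro L2_continuous continuous_intros)

lemma fourier_coeff_L2_limit:
  assumes v: "v \<in> L2"
    and lim: "(\<lambda>m. LINT z|circle. (cmod (v z - (\<Sum>k<m. a k * z ^ k)))\<^sup>2) \<longlonglongrightarrow> 0"
  shows "fourier_coeff v n = (if n \<ge> 0 then a (nat n) else 0)"
proof -
  let ?c = "if n \<ge> 0 then a (nat n) else 0"
  have "(\<lambda>m. LINT z|circle. z powi (- n) * (v z - (\<Sum>k<m. a k * z ^ k))) \<longlonglongrightarrow> 0"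
    by (rule L2_integral_mult_tendsto_0[OF L2_powi _ lim]) (intro L2_diff v L2_partial_sum)
  moreover have "\<forall>\<^sub>F m in sequentially.
      (LINT z|circle. z powi (- n) * (v z - (\<Sum>k<m. a k * z ^ k))) = fourier_coeff v n - ?c"
    using eventually_gt_at_top[of "nat n"]
  proof eventually_elim
    case (elim m)
    have "(LINT z|circle. z powi (- n) * (v z - (\<Sum>k<m. a k * z ^ k))) =
        (LINT z|circle. v z * z powi (- n) - (\<Sum>k<m. a k * z ^ k) * z powi (- n))"
      by (simp add: algebra_simps)
    also have "\<dots> = fourier_coeff v n - (LINT z|circle. (\<Sum>k<m. a k * z ^ k) * z powi (- n))"
      unfolding fourier_coeff_def
      by (intro Bochner_Integration.integral_diff L2_mult_integrable v L2_powi L2_partial_sum)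
    also have "(LINT z|circle. (\<Sum>k<m. a k * z ^ k) * z powi (- n)) = (\<Sum>k<m. if int k = n then a k else 0)"
      by (subst integral_sum_power_mult_powi) simp_all
    also have "\<dots> = ?c"
    proof (cases "n \<ge> 0")
      case True
      then have "(\<Sum>k<m. if int k = n then a k else 0) = (\<Sum>k<m. if k = nat n then a k else 0)"
        by (intro sum.cong) auto
      then show ?thesis
        using True elim by simp
    next
      case False
      then show ?thesis
        by (auto intro!: sum.neutral)
    qed
    finally show ?case .
  qed
  ultimately have "(\<lambda>m::nat. fourier_coeff v n - ?c) \<longlonglongrightarrow> 0"
    by (rule Lim_transform_eventually)
  then show ?thesis
    by (simp only: LIMSEQ_const_iff right_minus_eq)
qed

lemma H2_0_expansion:
  assumes v: "v \<in> H2_0"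
  obtains a where "a 0 = 0" "(\<lambda>m. LINT z|circle. (cmod (v z - (\<Sum>k<m. a k * z ^ k)))\<^sup>2) \<longlonglongrightarrow> 0"
proof -
  obtain a where a: "(\<lambda>m. LINT z|circle. (cmod (v z - (\<Sum>k<m. a k * z ^ k)))\<^sup>2) \<longlonglongrightarrow> 0"
    using v by (auto simp: H2_0_def H2_def)
  have "v \<in> L2" "fourier_coeff v 0 = 0"
    using v by (auto simp: H2_0_def H2_def)
  then have "a 0 = 0"
    using fourier_coeff_L2_limit[OF _ a, of 0] by simp
  then show ?thesis
    using a by (rule that)
qed

text \<open>Orthogonality to the positive powers extends to their closed span.\<close>

lemma H2_0_orthogonal:
  assumes w: "w \<in> L2" "\<And>k. k \<ge> 1 \<Longrightarrow> fourier_coeff w (int k) = 0" and v: "v \<in> H2_0"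
  shows "L2_inner w v = 0"
proof -
  obtain a where a: "a 0 = 0" "(\<lambda>m. LINT z|circle. (cmod (v z - (\<Sum>k<m. a k * z ^ k)))\<^sup>2) \<longlonglongrightarrow> 0"
    using H2_0_expansion[OF v] by blast
  have v2: "v \<in> L2"
    using v by (simp add: H2_0_def H2_def)
  have "(\<lambda>m. LINT z|circle. w z * cnj (v z - (\<Sum>k<m. a k * z ^ k))) \<longlonglongrightarrow> 0"
  proof (rule L2_integral_mult_tendsto_0[OF w(1)])
    show "(\<lambda>z. cnj (v z - (\<Sum>k<m. a k * z ^ k))) \<in> L2" for m
      by (intro L2_cnj L2_diff v2 L2_partial_sum)
    show "(\<lambda>m. LINT z|circle. (cmod (cnj (v z - (\<Sum>k<m. a k * z ^ k))))\<^sup>2) \<longlonglongrightarrow> 0"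
      unfolding complex_mod_cnj by (rule a(2))
  qed
  moreover have "(LINT z|circle. w z * cnj (v z - (\<Sum>k<m. a k * z ^ k))) = L2_inner w v" for m
  proof -
    have "(LINT z|circle. w z * cnj (v z - (\<Sum>k<m. a k * z ^ k))) =
        (LINT z|circle. w z * cnj (v z) - (\<Sum>k<m. cnj (a k) * (w z * z powi (- int k))))"
    proof (rule integral_circle_cong)
      fix z assume z: "cmod z = 1"
      have "cnj (z ^ k) = z powi (- int k)" for k
        using cnj_powi_circle[OF z, of "int k"] by simp
      then show "w z * cnj (v z - (\<Sum>k<m. a k * z ^ k)) =
          w z * cnj (v z) - (\<Sum>k<m. cnj (a k) * (w z * z powi (- int k)))"
        by (simp add: right_diff_distrib sum_distrib_left mult_ac del: complex_cnj_power)
    qed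
    also have "\<dots> = L2_inner w v - (LINT z|circle. (\<Sum>k<m. cnj (a k) * (w z * z powi (- int k))))"
      unfolding L2_inner_def
      by (intro Bochner_Integration.integral_diff Bochner_Integration.integrable_sum
          integrable_mult_right L2_mult_integrable w L2_cnj v2 L2_powi)
    also have "(LINT z|circle. (\<Sum>k<m. cnj (a k) * (w z * z powi (- int k)))) =
        (\<Sum>k<m. cnj (a k) * fourier_coeff w (int k))"
      unfolding fourier_coeff_def
      by (subst Bochner_Integration.integral_sum)
        (auto intro!: integrable_mult_right L2_mult_integrable w L2_powi simp del: power_int_minus)
    also have "\<dots> = 0"
    proof (intro sum.neutral ballI)
      fix k
      show "cnj (a k) * fourier_coeff w (int k) = 0"
        using w(2)[of k] a(1) by (cases "k = 0") auto
    qed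
    finally show ?thesis by simp
  qed
  ultimately show ?thesis
    by (simp only: LIMSEQ_const_iff)
qed

lemma power_in_H2_0:
  assumes "n \<ge> 1"
  shows "(\<lambda>z. z ^ n) \<in> H2_0"
proof -
  have L2: "(\<lambda>z::complex. z ^ n) \<in> L2"
    by (intro L2_continuous continuous_intros)
  define a :: "nat \<Rightarrow> complex" where "a k = (if k = n then 1 else 0)" for k
  have "summable (\<lambda>k. (cmod (a k))\<^sup>2)"
    by (rule summable_finite[of "{n}"]) (auto simp: a_def)
  moreover have "\<forall>\<^sub>F m in sequentially. 0 = (LINT z|circle. (cmod (z ^ n - (\<Sum>k<m. a k * z ^ k)))\<^sup>2)"
    using eventually_gt_at_top[of n]
  proof eventually_elim
    case (elim m)
    have "(\<Sum>k<m. a k * z ^ k) = (\<Sum>k<m. if k = n then z ^ k else 0)" for z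
      by (intro sum.cong) (auto simp: a_def)
    then show ?case using elim by simp
  qed
  then have "(\<lambda>m. LINT z|circle. (cmod (z ^ n - (\<Sum>k<m. a k * z ^ k)))\<^sup>2) \<longlonglongrightarrow> 0"
    by (rule Lim_transform_eventually[OF tendsto_const])
  ultimately have "(\<lambda>z. z ^ n) \<in> H2"
    using L2 by (auto simp: H2_def)
  moreover have "fourier_coeff (\<lambda>z. z ^ n) 0 = 0"
    using integral_circle_powi[of "int n"] assms by (simp add: fourier_coeff_def)
  ultimately show ?thesis
    by (simp add: H2_0_def)
qed

lemma bessel_summable:
  assumes h: "h \<in> L2"
  shows "summable (\<lambda>k. (cmod (fourier_coeff h (int k)))\<^sup>2)"
proof (rule summableI_nonneg_bounded)
  fix m
  define a where "a k = fourier_coeff h (int k)" for k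
  define S where "S z = (\<Sum>k<m. a k * z ^ k)" for z
  have S: "S \<in> L2" unfolding S_def by (rule L2_partial_sum)
  have int: "integrable circle (\<lambda>z. (cmod (h z))\<^sup>2)" "integrable circle (\<lambda>z. (cmod (S z))\<^sup>2)"
      "integrable circle (\<lambda>z. h z * cnj (S z))"
    using h S by (auto simp: L2_def intro: L2_mult_integrable[OF h L2_cnj[OF S]])
  have norm_S: "(LINT z|circle. (cmod (S z))\<^sup>2) = (\<Sum>k<m. (cmod (a k))\<^sup>2)"
    unfolding S_def by (rule integral_cmod_partial_sum_square) simp
  have "(LINT z|circle. h z * cnj (S z)) = (LINT z|circle. (\<Sum>k<m. cnj (a k) * (h z * z powi (- int k))))"
  proof (rule integral_circle_cong)
    fix z assume z: "cmod z = 1"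
    have "cnj (z ^ k) = z powi (- int k)" for k
      using cnj_powi_circle[OF z, of "int k"] by simp
    then show "h z * cnj (S z) = (\<Sum>k<m. cnj (a k) * (h z * z powi (- int k)))"
      by (simp add: S_def sum_distrib_left mult_ac del: complex_cnj_power)
  qed
  also have "\<dots> = (\<Sum>k<m. cnj (a k) * a k)"
    unfolding a_def fourier_coeff_def
    by (subst Bochner_Integration.integral_sum)
      (auto intro!: integrable_mult_right L2_mult_integrable h L2_powi)
  also have "\<dots> = complex_of_real (\<Sum>k<m. (cmod (a k))\<^sup>2)"
    by (simp add: complex_norm_square mult.commute del: of_real_power)
  finally have inner_S: "Re (LINT z|circle. h z * cnj (S z)) = (\<Sum>k<m. (cmod (a k))\<^sup>2)"
    by (simp only: Re_complex_of_real)
  have "0 \<le> (LINT z|circle. (cmod (h z - S z))\<^sup>2)"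
    by simp
  also have "\<dots> = (LINT z|circle. (cmod (h z))\<^sup>2 - 2 * Re (h z * cnj (S z)) + (cmod (S z))\<^sup>2)"
    by (rule integral_circle_cong) (simp add: cmod_power2, simp add: power2_eq_square algebra_simps)
  also have "\<dots> = (LINT z|circle. (cmod (h z))\<^sup>2) - 2 * Re (LINT z|circle. h z * cnj (S z)) + (LINT z|circle. (cmod (S z))\<^sup>2)"
    using int by (simp only: integral_Re[symmetric] Bochner_Integration.integral_add Bochner_Integration.integral_diff
        Bochner_Integration.integrable_diff integrable_mult_right integrable_Re Bochner_Integration.integral_mult_right_zero)
  also have "\<dots> = (LINT z|circle. (cmod (h z))\<^sup>2) - (\<Sum>k<m. (cmod (a k))\<^sup>2)"
    unfolding inner_S norm_S by simp
  finally show "(\<Sum>k<m. (cmod (fourier_coeff h (int k)))\<^sup>2) \<le> (LINT z|circle. (cmod (h z))\<^sup>2)"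
    by (simp add: a_def)
qed simp

lemma fourier_coeff_diff:
  assumes "f \<in> L2" "g \<in> L2"
  shows "fourier_coeff (\<lambda>z. f z - g z) n = fourier_coeff f n - fourier_coeff g n"
  unfolding fourier_coeff_def left_diff_distrib
  by (intro Bochner_Integration.integral_diff L2_mult_integrable assms L2_powi)

lemma H2_minus_coeff:
  assumes "g \<in> H2_minus" "n \<ge> 1"
  shows "fourier_coeff g (int n) = 0"
proof -
  have "L2_inner g (\<lambda>z. z ^ n) = 0"
    using assms power_in_H2_0 by (auto simp: H2_minus_def L2_ominus_def)
  moreover have "L2_inner g (\<lambda>z. z ^ n) = fourier_coeff g (int n)"
    unfolding L2_inner_def fourier_coeff_def
  proof (rule integral_circle_cong)
    fix z assume z: "cmod z = 1"
    show "g z * cnj (z ^ n) = g z * z powi (- int n)"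
      using cnj_powi_circle[OF z, of "int n"] by simp
  qed
  ultimately show ?thesis by simp
qed

lemma H2_minusI:
  assumes "g \<in> L2" "\<And>n. n \<ge> 1 \<Longrightarrow> fourier_coeff g (int n) = 0"
  shows "g \<in> H2_minus"
  using H2_0_orthogonal[OF assms] assms(1) by (simp add: H2_minus_def L2_ominus_def)

text \<open>The complementary projection is the Riesz-Fischer sum \<open>u\<close> of the positive modes of \<open>h\<close>, whose
coefficients are square-summable by Bessel's inequality; then \<open>h - u\<close> is the required function.\<close>

lemma H2_minus_projection_exists:
  assumes h: "h \<in> L2"
  shows "\<exists>g. g \<in> H2_minus \<and> (\<lambda>z. h z - g z) \<in> L2_ominus H2_minus"
proof -
  define a where "a k = (if k = 0 then 0 else fourier_coeff h (int k))" for k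
  have a: "summable (\<lambda>k. (cmod (a k))\<^sup>2)"
    by (rule summable_comparison_test'[OF bessel_summable[OF h], of 0]) (auto simp: a_def)
  obtain u where u: "u \<in> L2" "(\<lambda>m. LINT z|circle. (cmod (u z - (\<Sum>k<m. a k * z ^ k)))\<^sup>2) \<longlonglongrightarrow> 0"
    using riesz_fischer_circle[OF a] by blast
  have coeff_u: "fourier_coeff u n = (if n \<ge> 0 then a (nat n) else 0)" for n
    by (rule fourier_coeff_L2_limit[OF u])
  have u0: "u \<in> H2_0"
    using u a coeff_u[of 0] by (auto simp: H2_0_def H2_def a_def)
  have g: "(\<lambda>z. h z - u z) \<in> H2_minus"
    by (rule H2_minusI) (auto simp: L2_diff h u fourier_coeff_diff coeff_u a_def)
  have "L2_inner u g = 0" if "g \<in> H2_minus" for g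
  proof -
    have "L2_inner g u = 0"
      using that u0 by (auto simp: H2_minus_def L2_ominus_def)
    then have "cnj (L2_inner g u) = 0" by simp
    then show ?thesis
      unfolding L2_inner_def Bochner_Integration.integral_cnj[symmetric] by (simp add: mult.commute)
  qed
  then have "(\<lambda>z. h z - (h z - u z)) \<in> L2_ominus H2_minus"
    using u by (simp add: L2_ominus_def)
  then show ?thesis
    using g by blast
qed

text \<open>The chosen representative is determined by two orthogonality relations, which are tested on the positive
and on the nonpositive powers of \<open>z\<close>.\<close>

lemma
  assumes h: "h \<in> L2"
  shows R_minus_L2: "R_minus h \<in> L2"
    and fourier_coeff_R_minus: "fourier_coeff (R_minus h) n = (if n \<le> 0 then fourier_coeff h n else 0)"
proof -
  have R: "R_minus h \<in> H2_minus" "(\<lambda>z. h z - R_minus h z) \<in> L2_ominus H2_minus"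
    using someI_ex[OF H2_minus_projection_exists[OF h]] unfolding R_minus_def by auto
  then show L2: "R_minus h \<in> L2"
    by (simp add: H2_minus_def L2_ominus_def)
  show "fourier_coeff (R_minus h) n = (if n \<le> 0 then fourier_coeff h n else 0)"
  proof (cases "n \<le> 0")
    case True
    have "fourier_coeff (\<lambda>z. z powi n) k = 0" if "k \<ge> 1" for k
    proof -
      have "fourier_coeff (\<lambda>z. z powi n) k = (LINT z|circle. z powi (n - k))"
        unfolding fourier_coeff_def
      proof (rule integral_circle_cong)
        fix z :: complex assume "cmod z = 1"
        then have "z \<noteq> 0" by auto
        then show "z powi n * z powi (- k) = z powi (n - k)"
          by (simp add: power_int_diff power_int_minus field_simps)
      qed
      then show ?thesis
        using True that by (simp add: integral_circle_powi)
    qed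
    then have "(\<lambda>z. z powi n) \<in> H2_minus"
      by (intro H2_minusI L2_powi) simp
    then have "L2_inner (\<lambda>z. h z - R_minus h z) (\<lambda>z. z powi n) = 0"
      using R(2) by (simp add: L2_ominus_def)
    moreover have "L2_inner (\<lambda>z. h z - R_minus h z) (\<lambda>z. z powi n) = fourier_coeff (\<lambda>z. h z - R_minus h z) n"
      unfolding L2_inner_def fourier_coeff_def
      by (rule integral_circle_cong) (simp only: cnj_powi_circle)
    ultimately show ?thesis
      using True by (simp add: fourier_coeff_diff h L2)
  next
    case False
    then show ?thesis
      using H2_minus_coeff[OF R(1), of "nat n"] by simp
  qed
qed

section \<open>The quadratic form on the tree\<close>

text \<open>A word \<open>0\<^sup>a\<close> is on the trunk, and \<open>0\<^sup>a 1\<^sup>l\<close> with \<open>l \<ge> 1\<close> is on the branch leaving it at height \<open>a\<close>.  Two branch words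
are comparable only on the same branch, and a trunk word is comparable to a branch word only up to the
branching point.\<close>

lemma prefix_replicate_01:
  "prefix (replicate a (0::nat) @ replicate l 1) (replicate b 0 @ replicate m 1) \<longleftrightarrow>
    (if l = 0 then a \<le> b else a = b \<and> l \<le> m)"
proof (induction a arbitrary: b)
  case 0
  have ones: "prefix (replicate l (1::nat)) (replicate m 1) \<longleftrightarrow> l \<le> m" for l m
  proof (induction l arbitrary: m)
    case (Suc l)
    then show ?case by (cases m) auto
  qed simp
  show ?case
    by (cases b; cases l) (auto simp: ones[of "Suc _", simplified] ones)
next
  case (Suc a)
  show ?case
  proof (cases b)
    case 0
    then show ?thesis by (cases m) auto
  next
    case (Suc b')
    then show ?thesis using Suc.IH[of b'] by simp
  qed
qed

lemma block_index_le_iff: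
  fixes N :: nat
  assumes "r < N"
  shows "N * k' \<le> N * k + r \<longleftrightarrow> k' \<le> k"
proof
  assume "N * k' \<le> N * k + r"
  also have "\<dots> < N * Suc k" using assms by simp
  finally have "k' < Suc k"
    by (simp only: mult_less_cancel1)
  then show "k' \<le> k" by simp
next
  assume "k' \<le> k"
  then show "N * k' \<le> N * k + r"
    by (intro trans_le_add1 mult_le_mono2)
qed

lemma integrable_circle_continuous_mult_of_real:
  assumes "continuous_on (sphere 0 1) g" "integrable circle (\<phi> :: complex \<Rightarrow> real)"
  shows "integrable circle (\<lambda>z. g z * complex_of_real (\<phi> z))"
  by (rule integrable_circle_mult_continuous) (use assms in auto)

lemma sum_Times: "(\<Sum>i\<in>A \<times> B. h i) = (\<Sum>a\<in>A. \<Sum>b\<in>B. h (a, b))"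
  by (simp add: sum.cartesian_product)

text \<open>The three terms are the trunk-trunk, trunk-branch and branch-branch parts of the quadratic form
of the kernel at a combination \<open>\<Sum> g\<^sub>k V\<^sub>k + cnj \<mu> \<Sum> g\<^sub>k W\<^sub>k\<close> of block vectors \<open>V\<^sub>k\<close> and branch vectors \<open>W\<^sub>k\<close>, where
\<open>V\<^sub>k\<close> carries the coefficients of \<open>B\<^sub>0\<close> and \<open>W\<^sub>k\<close> the conjugates of those of \<open>f\<close>.  The restriction \<open>k \<le> j\<close> in the mixed term
records that a branch does not see the part of the trunk beyond its own root.  The sum over \<open>l\<close> starts at \<open>1\<close>:
a term with \<open>l = 0\<close> would lie on the trunk and spoil the orthogonality of the \<open>W\<^sub>k\<close>.\<close>

lemma tree_quadratic_inequality:
  fixes \<phi> :: "complex \<Rightarrow> real" and g b f :: "nat \<Rightarrow> complex" and \<mu> :: complex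
  assumes \<phi>: "hyper_positive 2 (\<lambda>z. complex_of_real (\<phi> z))" and N: "N \<ge> 1"
  shows "0 \<le> (LINT z|circle. (cmod (\<Sum>k<n. \<Sum>r<N. g k * b r * z ^ (N * k + r)))\<^sup>2 * \<phi> z)
    + 2 * Re (\<mu> * (\<Sum>j<n. \<Sum>k\<le>j. g j * cnj (g k) *
        (LINT z|circle. \<phi> z * (\<Sum>r<N. b r * z ^ r) * z ^ (N * (j - k)) * (\<Sum>l\<in>{1..L}. f l * z ^ l))))
    + (cmod \<mu>)\<^sup>2 * (\<Sum>k<n. (cmod (g k))\<^sup>2) * (LINT z|circle. (cmod (\<Sum>l\<in>{1..L}. f l * z ^ l))\<^sup>2 * \<phi> z)"
    (is "0 \<le> ?U + 2 * Re (\<mu> * ?X) + ?W")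
proof -
  define c where "c = fourier_coeff (\<lambda>z. complex_of_real (\<phi> z))"
  have int: "integrable circle \<phi>"
    using \<phi> by (simp add: hyper_positive_def complex_of_real_integrable_eq)
  define A where "A = {..<n} \<times> {..<N}"
  define B where "B = {..<n} \<times> {1..L}"
  \<comment> \<open>The trunk is numbered from the far end, so that the distance from a block entry to a branch
     word is a sum of exponents: the product \<open>B\<^sub>0 f\<close> appears, not \<open>cnj B\<^sub>0 f\<close>.  The branch of
     block \<open>k\<close> leaves at its last vertex, where \<open>r = 0\<close>.\<close>
  define wA where "wA = (\<lambda>(k, r). replicate (n * N - 1 - (N * k + r)) (0::nat))"
  define wB where "wB = (\<lambda>(k, l). replicate (n * N - 1 - N * k) (0::nat) @ replicate l 1)"
  define xA where "xA = (\<lambda>(k, r). g k * b r)"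
  define xB where "xB = (\<lambda>(k, l). cnj \<mu> * g k * cnj (f l))"
  define K where "K v w = (if prefix v w \<or> prefix w v then c (int (length w) - int (length v)) else 0)"
    for v w :: "nat list"
  have fin: "finite A" "finite B" by (auto simp: A_def B_def)
  have A_le: "N * k + r \<le> n * N - 1" if "k < n" "r < N" for k r
  proof -
    have "N * k + r < N * Suc k" using that by simp
    also have "\<dots> \<le> N * n" using that by (intro mult_le_mono2) simp
    finally show ?thesis by (simp add: mult.commute)
  qed
  have KAA: "K (wA (k, r)) (wA (k', r')) = c (- int (N * k' + r') - (- int (N * k + r)))"
    if "k < n" "r < N" "k' < n" "r' < N" for k r k' r'
  proof -
    have "prefix (wA (k, r)) (wA (k', r')) \<or> prefix (wA (k', r')) (wA (k, r))"
      using prefix_replicate_01[of _ 0 _ 0] by (auto simp: wA_def)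
    moreover have "int (length (wA (k', r'))) - int (length (wA (k, r))) = - int (N * k' + r') - (- int (N * k + r))"
      using A_le[of k r] A_le[of k' r'] that by (simp add: wA_def of_nat_diff del: of_nat_add of_nat_mult)
    ultimately show ?thesis
      by (simp only: K_def if_True)
  qed
  have KBA: "K (wB (k', l)) (wA (k, r)) = (if k' \<le> k then c (- int (N * (k - k') + r + l)) else 0)"
    if "k < n" "r < N" "k' < n" "l \<ge> 1" for k r k' l
  proof -
    have le: "N * k + r \<le> n * N - 1" "N * k' \<le> n * N - 1"
      using A_le[of k r] A_le[of k' 0] that by auto
    then have "n * N - 1 - (N * k + r) \<le> n * N - 1 - N * k' \<longleftrightarrow> N * k' \<le> N * k + r"
      by linarith
    then have pre: "prefix (wA (k, r)) (wB (k', l)) \<longleftrightarrow> k' \<le> k" "\<not> prefix (wB (k', l)) (wA (k, r))"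
      using prefix_replicate_01[of _ 0 _ l] prefix_replicate_01[of _ l _ 0] that
      by (auto simp: wA_def wB_def block_index_le_iff)
    have "int (length (wB (k', l))) - int (length (wA (k, r))) = int (N * (k - k') + r + l)" if "k' \<le> k"
    proof -
      have "N * (k - k') = N * k - N * k'" "N * k' \<le> N * k"
        using that by (simp_all add: diff_mult_distrib2)
      then show ?thesis
        using le unfolding wA_def wB_def prod.case length_append length_replicate by linarith
    qed
    then show ?thesis
      using pre unfolding K_def by (auto simp: algebra_simps)
  qed
  have KBB: "K (wB (k, l)) (wB (k', l')) = (if k = k' then c (int l' - int l) else 0)"
    if "k < n" "k' < n" "l \<ge> 1" "l' \<ge> 1" for k k' l l'
  proof -
    have le: "N * k \<le> n * N - 1" "N * k' \<le> n * N - 1"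
      using A_le[of k 0] A_le[of k' 0] that N by auto
    then have "n * N - 1 - N * k = n * N - 1 - N * k' \<longleftrightarrow> N * k = N * k'"
      by linarith
    then have eq: "n * N - 1 - N * k = n * N - 1 - N * k' \<longleftrightarrow> k = k'"
      using N by simp
    have "prefix (wB (k, l)) (wB (k', l')) \<or> prefix (wB (k', l')) (wB (k, l)) \<longleftrightarrow> k = k'"
      unfolding wB_def prod.case prefix_replicate_01 eq eq[unfolded eq_commute[of "n * N - 1 - N * k"]]
      using that by auto
    then show ?thesis
      by (auto simp: K_def wB_def)
  qed
  define x where "x = case_sum xA xB"
  define w where "w = case_sum wA wB"
  have pos: "(\<Sum>i\<in>A <+> B. \<Sum>j\<in>A <+> B. cnj (x i) * K (w i) (w j) * x j) \<in> \<real>\<^sub>\<ge>\<^sub>0"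
    unfolding K_def c_def
  proof (rule hyper_positive_form_nonneg[OF \<phi>])
    show "w i \<in> lists {..<2}" if "i \<in> A <+> B" for i
      using that by (auto simp: w_def wA_def wB_def split: sum.splits)
  qed (use fin in simp)
  have split: "(\<Sum>i\<in>A <+> B. \<Sum>j\<in>A <+> B. cnj (x i) * K (w i) (w j) * x j) =
      (\<Sum>i\<in>A. \<Sum>j\<in>A. cnj (xA i) * K (wA i) (wA j) * xA j)
      + ((\<Sum>i\<in>A. \<Sum>j\<in>B. cnj (xA i) * K (wA i) (wB j) * xB j)
        + (\<Sum>i\<in>B. \<Sum>j\<in>A. cnj (xB i) * K (wB i) (wA j) * xA j))
      + (\<Sum>i\<in>B. \<Sum>j\<in>B. cnj (xB i) * K (wB i) (wB j) * xB j)"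
    using fin by (simp add: sum.Plus x_def w_def sum.distrib)
  have AA: "(\<Sum>i\<in>A. \<Sum>j\<in>A. cnj (xA i) * K (wA i) (wA j) * xA j) = complex_of_real ?U"
  proof -
    define e where "e = (\<lambda>(k, r). - int (N * k + r))"
    have "(\<Sum>i\<in>A. \<Sum>j\<in>A. cnj (xA i) * K (wA i) (wA j) * xA j) =
        (\<Sum>i\<in>A. \<Sum>j\<in>A. cnj (xA i) * c (e j - e i) * xA j)"
      by (intro sum.cong refl) (auto simp: A_def KAA e_def simp del: of_nat_add of_nat_mult)
    also have "\<dots> = complex_of_real (LINT z|circle. (cmod (\<Sum>i\<in>A. xA i * z powi (- e i)))\<^sup>2 * \<phi> z)"
      unfolding c_def by (rule toeplitz_form_eq_integral[OF int])
    also have "(\<lambda>z. \<Sum>i\<in>A. xA i * z powi (- e i)) = (\<lambda>z. \<Sum>k<n. \<Sum>r<N. g k * b r * z ^ (N * k + r))"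
      unfolding A_def sum.cartesian_product
      by (intro ext sum.cong refl) (auto simp: xA_def e_def simp del: of_nat_add of_nat_mult)
    finally show ?thesis .
  qed
  have BB: "(\<Sum>i\<in>B. \<Sum>j\<in>B. cnj (xB i) * K (wB i) (wB j) * xB j) = complex_of_real ?W"
  proof -
    have "(\<Sum>i\<in>B. \<Sum>j\<in>B. cnj (xB i) * K (wB i) (wB j) * xB j) =
        (\<Sum>k<n. \<Sum>l\<in>{1..L}. \<Sum>k'<n. \<Sum>l'\<in>{1..L}. if k = k' then
          complex_of_real ((cmod \<mu>)\<^sup>2) * complex_of_real ((cmod (g k))\<^sup>2) * (cnj (cnj (f l)) * c (int l' - int l) * cnj (f l')) else 0)"
      unfolding B_def sum_Times
      by (intro sum.cong refl) (auto simp: KBB xB_def complex_norm_square mult_ac simp del: of_real_power)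
    also have "\<dots> = (\<Sum>k<n. \<Sum>l\<in>{1..L}. \<Sum>l'\<in>{1..L}.
          complex_of_real ((cmod \<mu>)\<^sup>2) * complex_of_real ((cmod (g k))\<^sup>2) * (cnj (cnj (f l)) * c (int l' - int l) * cnj (f l')))"
    proof (rule sum.cong[OF refl], rule sum.cong[OF refl])
      fix k l assume "k \<in> {..<n}"
      have "(\<Sum>k'<n. \<Sum>l'\<in>{1..L}. if k = k' then t l' else 0) = (\<Sum>l'\<in>{1..L}. t l')" for t :: "nat \<Rightarrow> complex"
      proof -
        have "(\<Sum>k'<n. \<Sum>l'\<in>{1..L}. if k = k' then t l' else 0) = (\<Sum>k'<n. if k = k' then \<Sum>l'\<in>{1..L}. t l' else 0)"
          by (intro sum.cong refl) auto
        then show ?thesis using \<open>k \<in> {..<n}\<close> by simp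
      qed
      then show "(\<Sum>k'<n. \<Sum>l'\<in>{1..L}. if k = k' then complex_of_real ((cmod \<mu>)\<^sup>2) * complex_of_real ((cmod (g k))\<^sup>2) *
          (cnj (cnj (f l)) * c (int l' - int l) * cnj (f l')) else 0) =
        (\<Sum>l'\<in>{1..L}. complex_of_real ((cmod \<mu>)\<^sup>2) * complex_of_real ((cmod (g k))\<^sup>2) *
          (cnj (cnj (f l)) * c (int l' - int l) * cnj (f l')))" .
    qed
    also have "\<dots> = (\<Sum>k<n. complex_of_real ((cmod \<mu>)\<^sup>2) * complex_of_real ((cmod (g k))\<^sup>2) *
        complex_of_real (LINT z|circle. (cmod (\<Sum>l\<in>{1..L}. cnj (f l) * z powi (- int l)))\<^sup>2 * \<phi> z))"
      unfolding toeplitz_form_eq_integral[OF int, symmetric] c_def sum_distrib_left ..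
    also have "(LINT z|circle. (cmod (\<Sum>l\<in>{1..L}. cnj (f l) * z powi (- int l)))\<^sup>2 * \<phi> z) =
        (LINT z|circle. (cmod (\<Sum>l\<in>{1..L}. f l * z ^ l))\<^sup>2 * \<phi> z)"
    proof (rule integral_circle_cong)
      fix z assume z: "cmod z = 1"
      have "(\<Sum>l\<in>{1..L}. cnj (f l) * z powi (- int l)) = cnj (\<Sum>l\<in>{1..L}. f l * z ^ l)"
        unfolding cnj_sum complex_cnj_mult using cnj_powi_circle[OF z, of "int _"] by (intro sum.cong refl) simp
      then show "(cmod (\<Sum>l\<in>{1..L}. cnj (f l) * z powi (- int l)))\<^sup>2 * \<phi> z = (cmod (\<Sum>l\<in>{1..L}. f l * z ^ l))\<^sup>2 * \<phi> z"
        by (simp only: complex_mod_cnj)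
    qed
    finally show ?thesis
      by (simp add: sum_distrib_left sum_distrib_right)
  qed
  have BA: "(\<Sum>i\<in>B. \<Sum>j\<in>A. cnj (xB i) * K (wB i) (wA j) * xA j) = \<mu> * ?X"
  proof -
    have moment: "(LINT z|circle. \<phi> z * (\<Sum>r<N. b r * z ^ r) * z ^ m * (\<Sum>l\<in>{1..L}. f l * z ^ l)) =
        (\<Sum>r<N. \<Sum>l\<in>{1..L}. b r * f l * c (- int (m + r + l)))" for m
    proof -
      have "(LINT z|circle. \<phi> z * (\<Sum>r<N. b r * z ^ r) * z ^ m * (\<Sum>l\<in>{1..L}. f l * z ^ l)) =
          (LINT z|circle. (\<Sum>r<N. \<Sum>l\<in>{1..L}. b r * f l * (z ^ (m + r + l) * complex_of_real (\<phi> z))))"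
        by (rule integral_circle_cong)
          (simp add: sum_distrib_left sum_distrib_right power_add mult_ac)
      also have "\<dots> = (\<Sum>r<N. \<Sum>l\<in>{1..L}. b r * f l * (LINT z|circle. z ^ (m + r + l) * complex_of_real (\<phi> z)))"
      proof -
        have "integrable circle (\<lambda>z. z ^ k * complex_of_real (\<phi> z))" for k
          by (intro integrable_circle_continuous_mult_of_real int continuous_intros)
        then show ?thesis
          by (subst Bochner_Integration.integral_sum; simp)+
      qed
      finally show ?thesis
        by (simp add: c_def fourier_coeff_def mult_ac del: of_nat_add)
    qed
    have "(\<Sum>i\<in>B. \<Sum>j\<in>A. cnj (xB i) * K (wB i) (wA j) * xA j) =
        (\<Sum>j\<in>A. \<Sum>i\<in>B. cnj (xB i) * K (wB i) (wA j) * xA j)"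
      by (rule sum.swap)
    also have "\<dots> = (\<Sum>k<n. \<Sum>r<N. \<Sum>k'<n. \<Sum>l\<in>{1..L}. if k' \<le> k then
        \<mu> * (g k * cnj (g k') * (b r * f l * c (- int (N * (k - k') + r + l)))) else 0)"
      unfolding A_def B_def sum_Times
      by (intro sum.cong refl) (auto simp: KBA xA_def xB_def mult_ac simp del: of_nat_add of_nat_mult)
    also have "\<dots> = (\<Sum>k<n. \<Sum>k'<n. if k' \<le> k then \<Sum>r<N. \<Sum>l\<in>{1..L}.
        \<mu> * (g k * cnj (g k') * (b r * f l * c (- int (N * (k - k') + r + l)))) else 0)"
      by (subst sum.swap, intro sum.cong refl) auto
    also have "\<dots> = (\<Sum>k<n. \<Sum>k'\<le>k. \<Sum>r<N. \<Sum>l\<in>{1..L}.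
        \<mu> * (g k * cnj (g k') * (b r * f l * c (- int (N * (k - k') + r + l)))))"
    proof (rule sum.cong[OF refl])
      fix k assume "k \<in> {..<n}"
      then have "{k'. k' \<in> {..<n} \<and> k' \<le> k} = {..k}" by auto
      then show "(\<Sum>k'<n. if k' \<le> k then t k' else 0) = (\<Sum>k'\<le>k. t k')" for t :: "nat \<Rightarrow> complex"
        by (subst sum.inter_filter[symmetric]) simp_all
    qed
    also have "\<dots> = \<mu> * ?X"
      unfolding moment by (simp add: sum_distrib_left)
    finally show ?thesis .
  qed
  have AB: "(\<Sum>i\<in>A. \<Sum>j\<in>B. cnj (xA i) * K (wA i) (wB j) * xB j) = cnj (\<mu> * ?X)"
  proof -
    have K: "cnj (K v w) = K w v" for v w
      by (auto simp: K_def c_def cnj_fourier_coeff)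
    show ?thesis
      unfolding BA[symmetric] cnj_sum by (subst sum.swap) (simp add: K mult_ac)
  qed
  have hermitian: "cnj z + z = complex_of_real (2 * Re z)" for z
    using complex_add_cnj[of z] by (simp add: add.commute)
  have "complex_of_real (?U + 2 * Re (\<mu> * ?X) + ?W) \<in> \<real>\<^sub>\<ge>\<^sub>0"
    using pos unfolding split AA AB BA BB hermitian of_real_add .
  then show ?thesis
    by (simp only: nonneg_Reals_of_real_iff)
qed

section \<open>The pointwise inequality\<close>

text \<open>Replace \<open>f\<close> by its Fourier partial sums and pass to the limit in \<open>L\<^sup>2\<close>; boundedness of \<open>\<phi>\<close> makes
the weighted norm and the pairings continuous there.\<close>

lemma hankel_pairing_nonneg:
  fixes \<phi> :: "complex \<Rightarrow> real" and g b :: "nat \<Rightarrow> complex" and f :: "complex \<Rightarrow> complex" and \<mu> :: complex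
  assumes nonneg: "AE z in circle. \<phi> z \<ge> 0"
    and \<phi>: "hyper_positive 2 (\<lambda>z. complex_of_real (\<phi> z))"
    and bounded: "AE z in circle. \<phi> z \<le> M" and N: "N \<ge> 1" and f: "f \<in> H2_0"
  shows "0 \<le> (LINT z|circle. (cmod (\<Sum>k<n. \<Sum>r<N. g k * b r * z ^ (N * k + r)))\<^sup>2 * \<phi> z)
    + 2 * Re (\<mu> * (\<Sum>j<n. \<Sum>k\<le>j. g j * cnj (g k) *
        (LINT z|circle. \<phi> z * (\<Sum>r<N. b r * z ^ r) * z ^ (N * (j - k)) * f z)))
    + (cmod \<mu>)\<^sup>2 * (\<Sum>k<n. (cmod (g k))\<^sup>2) * (LINT z|circle. (cmod (f z))\<^sup>2 * \<phi> z)"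
    (is "0 \<le> ?U + 2 * Re (\<mu> * ?X f) + (cmod \<mu>)\<^sup>2 * ?G * ?C f")
proof -
  obtain a where a: "a 0 = 0" "(\<lambda>m. LINT z|circle. (cmod (f z - (\<Sum>k<m. a k * z ^ k)))\<^sup>2) \<longlonglongrightarrow> 0"
    using H2_0_expansion[OF f] by blast
  define S where "S m z = (\<Sum>l\<in>{1..m}. a l * z ^ l)" for m and z :: complex
  have S_eq: "S m z = (\<Sum>k<Suc m. a k * z ^ k)" for m z
    unfolding S_def lessThan_Suc_atMost
    by (rule sum.mono_neutral_left) (use a(1) in \<open>auto simp: Suc_le_eq intro: gr0I\<close>)
  have lim: "(\<lambda>m. LINT z|circle. (cmod (f z - S m z))\<^sup>2) \<longlonglongrightarrow> 0"
    unfolding S_eq using LIMSEQ_Suc[OF a(2)] .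
  have f2: "f \<in> L2"
    using f by (simp add: H2_0_def H2_def)
  have S2: "S m \<in> L2" for m
    unfolding S_def by (rule L2_partial_sum)
  have int: "integrable circle \<phi>"
    using \<phi> by (simp add: hyper_positive_def complex_of_real_integrable_eq)
  note [measurable] = int[THEN borel_measurable_integrable]
  have abs_\<phi>: "AE z in circle. cmod (complex_of_real (\<phi> z)) \<le> M"
    using nonneg bounded by eventually_elim simp
  have \<phi>_L2: "(\<lambda>z. complex_of_real (\<phi> z) * h z) \<in> L2" if "h \<in> L2" for h
    by (rule L2_bounded_mult[OF _ abs_\<phi> that]) measurable
  have pair: "(\<lambda>m. LINT z|circle. u z * S m z) \<longlonglongrightarrow> (LINT z|circle. u z * f z)" if u: "u \<in> L2" for u
  proof -
    have "(\<lambda>m. (LINT z|circle. u z * f z) - (LINT z|circle. u z * (f z - S m z))) \<longlonglongrightarrow> (LINT z|circle. u z * f z) - 0"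
      by (intro tendsto_intros L2_integral_mult_tendsto_0[OF u _ lim] L2_diff f2 S2)
    moreover have "(LINT z|circle. u z * (f z - S m z)) = (LINT z|circle. u z * f z) - (LINT z|circle. u z * S m z)" for m
      unfolding right_diff_distrib
      by (intro Bochner_Integration.integral_diff L2_mult_integrable u f2 S2)
    ultimately show ?thesis by simp
  qed
  have C_lim: "(\<lambda>m. ?C (S m)) \<longlonglongrightarrow> ?C f"
  proof -
    define u where "u z = complex_of_real (\<phi> z) * cnj (f z)" for z
    have u: "u \<in> L2"
      unfolding u_def by (intro \<phi>_L2 L2_cnj f2)
    have int_\<phi>: "integrable circle (\<lambda>z. (cmod (h z))\<^sup>2 * \<phi> z)" if "h \<in> L2" for h
    proof -
      have "integrable circle (\<lambda>z. complex_of_real (\<phi> z) * h z * cnj (h z))"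
        by (intro L2_mult_integrable \<phi>_L2 L2_cnj that)
      then have "integrable circle (\<lambda>z. Re (complex_of_real (\<phi> z) * h z * cnj (h z)))"
        by (rule integrable_Re)
      moreover have "Re (complex_of_real (\<phi> z) * h z * cnj (h z)) = (cmod (h z))\<^sup>2 * \<phi> z" for z
        by (simp add: cmod_power2, simp add: power2_eq_square algebra_simps)
      ultimately show ?thesis
        by simp
    qed
    \<comment> \<open>Expanding around \<open>f\<close> leaves a pairing with \<open>f - S m\<close> and its own weighted norm, both of which vanish in the limit.\<close>
    have square: "?C (S m) = ?C f - 2 * Re (LINT z|circle. u z * (f z - S m z)) + (LINT z|circle. (cmod (f z - S m z))\<^sup>2 * \<phi> z)" for m
    proof -
      have "?C (S m) = (LINT z|circle. (cmod (f z))\<^sup>2 * \<phi> z - 2 * Re (u z * (f z - S m z)) + (cmod (f z - S m z))\<^sup>2 * \<phi> z)"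
        by (rule integral_circle_cong) (simp add: u_def cmod_power2, simp add: power2_eq_square algebra_simps)
      also have "\<dots> = ?C f - 2 * Re (LINT z|circle. u z * (f z - S m z)) + (LINT z|circle. (cmod (f z - S m z))\<^sup>2 * \<phi> z)"
        using int_\<phi>[OF f2] int_\<phi>[OF L2_diff[OF f2 S2[of m]]] L2_mult_integrable[OF u L2_diff[OF f2 S2[of m]]]
        by (simp only: integral_Re[symmetric] Bochner_Integration.integral_add Bochner_Integration.integral_diff
          Bochner_Integration.integrable_diff integrable_mult_right integrable_Re Bochner_Integration.integral_mult_right_zero)
      finally show ?thesis .
    qed
    have "(\<lambda>m. LINT z|circle. (cmod (f z - S m z))\<^sup>2 * \<phi> z) \<longlonglongrightarrow> 0"
    proof (rule tendsto_sandwich[OF _ _ tendsto_const])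
      show "\<forall>\<^sub>F m in sequentially. 0 \<le> (LINT z|circle. (cmod (f z - S m z))\<^sup>2 * \<phi> z)"
        by (intro always_eventually allI integral_nonneg_AE eventually_mono[OF nonneg]) simp
      have "(LINT z|circle. (cmod (f z - S m z))\<^sup>2 * \<phi> z) \<le> (LINT z|circle. M * (cmod (f z - S m z))\<^sup>2)" for m
      proof (rule integral_mono_AE)
        show "integrable circle (\<lambda>z. (cmod (f z - S m z))\<^sup>2 * \<phi> z)"
          by (intro int_\<phi> L2_diff f2 S2)
        show "integrable circle (\<lambda>z. M * (cmod (f z - S m z))\<^sup>2)"
          using L2_diff[OF f2 S2[of m]] by (simp add: L2_def)
        show "AE z in circle. (cmod (f z - S m z))\<^sup>2 * \<phi> z \<le> M * (cmod (f z - S m z))\<^sup>2"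
          using bounded by eventually_elim (subst mult.commute, intro mult_right_mono, auto)
      qed
      then show "\<forall>\<^sub>F m in sequentially. (LINT z|circle. (cmod (f z - S m z))\<^sup>2 * \<phi> z) \<le> M * (LINT z|circle. (cmod (f z - S m z))\<^sup>2)"
        by simp
      show "(\<lambda>m. M * (LINT z|circle. (cmod (f z - S m z))\<^sup>2)) \<longlonglongrightarrow> 0"
        using tendsto_mult_left[OF lim, of M] by simp
    qed
    moreover have "(\<lambda>m. LINT z|circle. u z * (f z - S m z)) \<longlonglongrightarrow> 0"
      by (rule L2_integral_mult_tendsto_0[OF u _ lim]) (intro L2_diff f2 S2)
    ultimately have "(\<lambda>m. ?C (S m)) \<longlonglongrightarrow> ?C f - 2 * Re 0 + 0"
      unfolding square by (intro tendsto_intros)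
    then show ?thesis by simp
  qed
  have X_lim: "(\<lambda>m. ?X (S m)) \<longlonglongrightarrow> ?X f"
  proof (intro tendsto_intros pair)
    show "(\<lambda>z. complex_of_real (\<phi> z) * (\<Sum>r<N. b r * z ^ r) * z ^ k) \<in> L2" for k
      unfolding mult.assoc by (intro \<phi>_L2 L2_continuous continuous_intros)
  qed
  have "(\<lambda>m. ?U + 2 * Re (\<mu> * ?X (S m)) + (cmod \<mu>)\<^sup>2 * ?G * ?C (S m)) \<longlonglongrightarrow>
      ?U + 2 * Re (\<mu> * ?X f) + (cmod \<mu>)\<^sup>2 * ?G * ?C f"
    by (intro tendsto_intros X_lim C_lim)
  then show ?thesis
    by (rule LIMSEQ_le_const) (use tree_quadratic_inequality[OF \<phi> N] in \<open>auto simp: S_def\<close>)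
qed

text \<open>Put \<open>\<mu> = - t cnj A\<close>; the minimum over real \<open>t\<close> is at \<open>t = 1 / C\<close>.  For \<open>C = 0\<close> the
expression is affine in \<open>t\<close>, which forces \<open>A = 0\<close>.\<close>

lemma pairing_nonneg_imp_cmod_square_le:
  fixes A :: complex and C D :: real
  assumes "\<And>\<mu>::complex. 0 \<le> D + 2 * Re (\<mu> * A) + (cmod \<mu>)\<^sup>2 * C"
  shows "0 \<le> D" "0 \<le> C \<Longrightarrow> (cmod A)\<^sup>2 \<le> C * D"
proof -
  show D: "0 \<le> D" using assms[of 0] by simp
  have t: "0 \<le> D - 2 * t * (cmod A)\<^sup>2 + t\<^sup>2 * (cmod A)\<^sup>2 * C" for t :: real
  proof -
    have "complex_of_real (- t) * cnj A * A = complex_of_real (- t * (cmod A)\<^sup>2)"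
      by (simp add: complex_norm_square mult_ac del: of_real_power)
    then have "Re (complex_of_real (- t) * cnj A * A) = - t * (cmod A)\<^sup>2"
      by (simp only: Re_complex_of_real)
    then show ?thesis
      using assms[of "complex_of_real (- t) * cnj A"] by (simp add: norm_mult power_mult_distrib)
  qed
  show "(cmod A)\<^sup>2 \<le> C * D" if "0 \<le> C"
  proof (cases "C = 0")
    case True
    show ?thesis
    proof (cases "A = 0")
      case False
      then have "(D + 1) / (cmod A)\<^sup>2 * (cmod A)\<^sup>2 = D + 1" by simp
      then show ?thesis
        using False t[of "(D + 1) / (cmod A)\<^sup>2"] D True by simp
    qed (simp add: True)
  next
    case False
    then show ?thesis
      using t[of "1 / C"] that by (simp add: field_simps power2_eq_square)
  qed
qed

text \<open>Exchanges the quantifiers \<open>for all p\<close> and \<open>almost everywhere\<close>, by restricting \<open>p\<close> to a countable dense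
set.\<close>

lemma AE_nonneg_separable_parameter:
  fixes \<psi> :: "'p::{second_countable_topology} \<Rightarrow> 'a \<Rightarrow> real"
  assumes cont: "\<And>z. continuous_on UNIV (\<lambda>p. \<psi> p z)" and ae: "\<And>p. AE z in M. 0 \<le> \<psi> p z"
  shows "AE z in M. \<forall>p. 0 \<le> \<psi> p z"
proof -
  obtain Q :: "'p set" where Q: "countable Q" "\<And>X. open X \<Longrightarrow> X \<noteq> {} \<Longrightarrow> \<exists>d\<in>Q. d \<in> X"
    by (rule countable_dense_setE) blast
  have dense: "p \<in> closure Q" for p
    unfolding closure_iff_nhds_not_empty using Q(2) by (metis disjoint_iff open_contains_ball subsetD empty_iff)
  have "AE z in M. \<forall>p\<in>Q. 0 \<le> \<psi> p z"
    unfolding AE_ball_countable[OF Q(1)] using ae by blast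
  then show ?thesis
  proof eventually_elim
    case (elim z)
    have "closed {p. 0 \<le> \<psi> p z}"
      by (intro closed_Collect_le cont continuous_intros)
    then have "closure Q \<subseteq> {p. 0 \<le> \<psi> p z}"
      using elim by (intro closure_minimal) auto
    then show ?case using dense by blast
  qed
qed

lemma cmod_poly_square_eq_sum:
  assumes "cmod z = 1"
  shows "complex_of_real ((cmod (poly q z))\<^sup>2) =
    (\<Sum>j\<le>degree q. \<Sum>k\<le>degree q. coeff q j * cnj (coeff q k) * z powi (int j - int k))"
proof -
  have "poly q z = (\<Sum>k\<le>degree q. coeff q k * z powi (- (- int k)))"
    by (simp add: poly_altdef)
  then have "complex_of_real ((cmod (poly q z))\<^sup>2) =
      (\<Sum>k\<le>degree q. \<Sum>j\<le>degree q. cnj (coeff q k) * coeff q j * z powi (- int k - (- int j)))"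
    using cmod_sum_powi_square[OF assms, of "\<lambda>k. coeff q k" "\<lambda>k. - int k"] by simp
  also have "\<dots> = (\<Sum>j\<le>degree q. \<Sum>k\<le>degree q. coeff q j * cnj (coeff q k) * z powi (int j - int k))"
    by (subst sum.swap) (simp add: mult_ac)
  finally show ?thesis .
qed

text \<open>Expanding the square gives the Fourier coefficients of the projection at the multiples
\<open>- N (j - k)\<close>; the projection kills those with \<open>j < k\<close>.\<close>

lemma integral_cmod_poly_power_R_minus:
  assumes h: "h \<in> L2" and N: "N \<ge> 1"
  shows "(LINT w|circle. complex_of_real ((cmod (poly q (w ^ N)))\<^sup>2) * R_minus h w) =
    (\<Sum>j\<le>degree q. \<Sum>k\<le>j. coeff q j * cnj (coeff q k) * (LINT w|circle. h w * w ^ (N * (j - k))))"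
proof -
  define d where "d = degree q"
  have R: "R_minus h \<in> L2" by (rule R_minus_L2[OF h])
  have "(LINT w|circle. complex_of_real ((cmod (poly q (w ^ N)))\<^sup>2) * R_minus h w) =
      (LINT w|circle. (\<Sum>j\<le>d. \<Sum>k\<le>d. coeff q j * cnj (coeff q k) * (R_minus h w * w powi (- (- (int N * (int j - int k)))))))"
  proof (rule integral_circle_cong)
    fix w :: complex assume "cmod w = 1"
    then have "cmod (w ^ N) = 1" by (simp add: norm_power)
    moreover have "(w ^ N) powi m = w powi (- (- (int N * m)))" for m
      by (simp add: power_int_mult)
    ultimately show "complex_of_real ((cmod (poly q (w ^ N)))\<^sup>2) * R_minus h w =
        (\<Sum>j\<le>d. \<Sum>k\<le>d. coeff q j * cnj (coeff q k) * (R_minus h w * w powi (- (- (int N * (int j - int k))))))"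
      unfolding d_def by (subst cmod_poly_square_eq_sum) (simp_all only: sum_distrib_left sum_distrib_right mult_ac)
  qed
  also have "\<dots> = (\<Sum>j\<le>d. \<Sum>k\<le>d. coeff q j * cnj (coeff q k) * fourier_coeff (R_minus h) (- (int N * (int j - int k))))"
  proof -
    have "integrable circle (\<lambda>w. R_minus h w * w powi n)" for n
      by (intro L2_mult_integrable R L2_powi)
    then show ?thesis
      unfolding fourier_coeff_def by (subst Bochner_Integration.integral_sum; simp)+
  qed
  also have "\<dots> = (\<Sum>j\<le>d. \<Sum>k\<le>d. if k \<le> j then coeff q j * cnj (coeff q k) * (LINT w|circle. h w * w ^ (N * (j - k))) else 0)"
  proof (intro sum.cong refl)
    fix j k
    have "- (int N * (int j - int k)) \<le> 0 \<longleftrightarrow> k \<le> j"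
      using N by (simp add: zero_le_mult_iff)
    moreover have "fourier_coeff h (- (int N * (int j - int k))) = (LINT w|circle. h w * w ^ (N * (j - k)))" if "k \<le> j"
    proof -
      have "int N * (int j - int k) = int (N * (j - k))"
        using that by (simp add: of_nat_diff)
      then show ?thesis
        by (simp only: fourier_coeff_def minus_minus power_int_of_nat)
    qed
    ultimately show "coeff q j * cnj (coeff q k) * fourier_coeff (R_minus h) (- (int N * (int j - int k))) =
        (if k \<le> j then coeff q j * cnj (coeff q k) * (LINT w|circle. h w * w ^ (N * (j - k))) else 0)"
      by (simp add: fourier_coeff_R_minus[OF h])
  qed
  also have "\<dots> = (\<Sum>j\<le>d. \<Sum>k\<le>j. coeff q j * cnj (coeff q k) * (LINT w|circle. h w * w ^ (N * (j - k))))"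
  proof (rule sum.cong[OF refl])
    fix j assume "j \<in> {..d}"
    then have "{k \<in> {..d}. k \<le> j} = {..j}" by auto
    then show "(\<Sum>k\<le>d. if k \<le> j then t k else 0) = (\<Sum>k\<le>j. t k)" for t :: "nat \<Rightarrow> complex"
      by (subst sum.inter_filter[symmetric]) simp_all
  qed
  finally show ?thesis unfolding d_def .
qed

text \<open>Evaluates the integral of \<open>|q|\<^sup>2 (D + 2 Re (\<mu> A) + |\<mu>|\<^sup>2 C)\<close> for a polynomial \<open>q\<close> term by term, and
recognises the form of \<open>hankel_pairing_nonneg\<close>; the first two terms are moved from \<open>z\<close> to \<open>w\<close> with \<open>z = w\<^sup>N\<close> by
\<open>integral_mult_E_op\<close>.\<close>

lemma E_op_hankel_square_le:
  fixes \<phi> :: "complex \<Rightarrow> real" and N :: nat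
    and f :: "complex \<Rightarrow> complex" and b :: "nat \<Rightarrow> complex"
  assumes nonneg: "AE z in circle. \<phi> z \<ge> 0"
    and hyper: "hyper_positive 2 (\<lambda>z. complex_of_real (\<phi> z))"
    and N: "N \<ge> 1" and f: "f \<in> H2_0"
  defines "B0 \<equiv> \<lambda>z. \<Sum>n<N. b n * z ^ n"
  defines "R \<equiv> hankel (\<lambda>z. complex_of_real (\<phi> z)) (\<lambda>z. B0 z * f z)"
  defines "D \<equiv> E_op N (\<lambda>z. (cmod (B0 z))\<^sup>2 * \<phi> z)"
  defines "C \<equiv> (LINT z|circle. (cmod (f z))\<^sup>2 * \<phi> z)"
  shows "R \<in> L2"
    and "AE z in circle. 0 \<le> D z \<and> (cmod (E_op N R z))\<^sup>2 \<le> C * D z"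
proof -
  have int: "integrable circle \<phi>"
    using hyper by (simp add: hyper_positive_def complex_of_real_integrable_eq)
  note [measurable] = int[THEN borel_measurable_integrable]
  obtain M where M: "AE z in circle. \<phi> z \<le> M"
    using hyper_positive_ess_bounded[OF hyper] by auto
  have B0_cont: "continuous_on (sphere 0 1) B0"
    unfolding B0_def by (intro continuous_intros)
  obtain \<beta> where \<beta>: "\<And>z. cmod z = 1 \<Longrightarrow> cmod (B0 z) \<le> \<beta>"
    using continuous_on_circle_bounded[OF B0_cont] by blast
  have f2: "f \<in> L2"
    using f by (simp add: H2_0_def H2_def)
  define h where "h z = complex_of_real (\<phi> z) * (B0 z * f z)" for z
  have h: "h \<in> L2"
    unfolding h_def
  proof (rule L2_bounded_mult)
    show "AE z in circle. cmod (complex_of_real (\<phi> z)) \<le> M"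
      using nonneg M by eventually_elim simp
    show "(\<lambda>z. B0 z * f z) \<in> L2"
      by (rule L2_bounded_mult[OF borel_measurable_circle_continuous[OF B0_cont] _ f2])
        (use \<beta> in \<open>auto intro: eventually_mono[OF AE_circle_norm]\<close>)
  qed measurable
  have R_eq: "R = R_minus h"
    by (simp add: R_def hankel_def h_def[abs_def])
  show R2: "R \<in> L2"
    unfolding R_eq by (rule R_minus_L2[OF h])
  have R_int: "integrable circle R"
    using L2_mult_integrable[OF R2 L2_powi[of 0]] by simp
  have B\<phi>_int: "integrable circle (\<lambda>z. (cmod (B0 z))\<^sup>2 * \<phi> z)"
    by (intro integrable_circle_mult_continuous int continuous_intros B0_cont)
  define A where "A = E_op N R"
  have A_int: "integrable circle A" and D_int: "integrable circle D"
    unfolding A_def D_def by (intro integrable_E_op N R_int B\<phi>_int)+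
  define \<psi> where "\<psi> \<mu> z = D z + 2 * Re (\<mu> * A z) + (cmod \<mu>)\<^sup>2 * C" for \<mu> z
  have \<psi>: "AE z in circle. 0 \<le> \<psi> \<mu> z" for \<mu>
  proof (rule AE_nonneg_circle)
    show "integrable circle (\<psi> \<mu>)"
      unfolding \<psi>_def using A_int D_int by simp
    fix q :: "complex poly"
    have cont: "continuous_on (sphere 0 1) (\<lambda>z. (cmod (poly q z))\<^sup>2)"
      by (intro continuous_intros)
    have mult_int: "integrable circle (\<lambda>z. (cmod (poly q z))\<^sup>2 * g z)" if "integrable circle g" for g :: "complex \<Rightarrow> real"
      by (rule integrable_circle_mult_continuous[OF cont that])
    have qA_int: "integrable circle (\<lambda>z. complex_of_real ((cmod (poly q z))\<^sup>2) * A z)"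
      by (intro integrable_circle_mult_continuous A_int continuous_intros)
    have D_part: "(LINT z|circle. (cmod (poly q z))\<^sup>2 * D z) =
        (LINT z|circle. (cmod (\<Sum>k<Suc (degree q). \<Sum>r<N. coeff q k * b r * z ^ (N * k + r)))\<^sup>2 * \<phi> z)"
    proof -
      have P: "(\<Sum>k<Suc (degree q). \<Sum>r<N. coeff q k * b r * w ^ (N * k + r)) = poly q (w ^ N) * B0 w" for w
        unfolding poly_altdef lessThan_Suc_atMost B0_def sum_product
        by (intro sum.cong refl) (simp add: power_add power_mult)
      have "(LINT z|circle. (cmod (poly q z))\<^sup>2 * D z) = (LINT w|circle. (cmod (poly q (w ^ N)))\<^sup>2 * ((cmod (B0 w))\<^sup>2 * \<phi> w))"
        unfolding D_def using integral_mult_E_op[OF N cont B\<phi>_int] by simp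
      then show ?thesis
        unfolding P by (simp add: norm_mult power_mult_distrib mult_ac)
    qed
    have A_part: "(LINT z|circle. complex_of_real ((cmod (poly q z))\<^sup>2) * A z) =
        (\<Sum>j<Suc (degree q). \<Sum>k\<le>j. coeff q j * cnj (coeff q k) *
          (LINT z|circle. \<phi> z * (\<Sum>r<N. b r * z ^ r) * z ^ (N * (j - k)) * f z))"
    proof -
      have "(LINT z|circle. complex_of_real ((cmod (poly q z))\<^sup>2) * A z) =
          (LINT w|circle. complex_of_real ((cmod (poly q (w ^ N)))\<^sup>2) * R_minus h w)"
        unfolding A_def R_eq[symmetric] using integral_mult_E_op[OF N cont R_int]
        by (simp add: scaleR_conv_of_real)
      also have "\<dots> = (\<Sum>j\<le>degree q. \<Sum>k\<le>j. coeff q j * cnj (coeff q k) * (LINT w|circle. h w * w ^ (N * (j - k))))"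
        by (rule integral_cmod_poly_power_R_minus[OF h N])
      also have "\<dots> = (\<Sum>j<Suc (degree q). \<Sum>k\<le>j. coeff q j * cnj (coeff q k) *
          (LINT z|circle. \<phi> z * (\<Sum>r<N. b r * z ^ r) * z ^ (N * (j - k)) * f z))"
        unfolding lessThan_Suc_atMost h_def B0_def by (simp add: mult_ac)
      finally show ?thesis .
    qed
    have C_part: "(LINT z|circle. (cmod (poly q z))\<^sup>2) = (\<Sum>k<Suc (degree q). (cmod (coeff q k))\<^sup>2)"
      unfolding poly_altdef lessThan_Suc_atMost by (rule integral_cmod_partial_sum_square) simp
    have i1: "integrable circle (\<lambda>z. (cmod (poly q z))\<^sup>2 * D z)"
      by (rule mult_int[OF D_int])
    have i2: "integrable circle (\<lambda>z. 2 * Re (\<mu> * (complex_of_real ((cmod (poly q z))\<^sup>2) * A z)))"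
      by (intro integrable_mult_right integrable_Re qA_int)
    have i3: "integrable circle (\<lambda>z. (cmod \<mu>)\<^sup>2 * C * ((cmod (poly q z))\<^sup>2 * 1))"
      by (intro integrable_mult_right mult_int) simp
    have A_Re: "(LINT z|circle. Re (\<mu> * (complex_of_real ((cmod (poly q z))\<^sup>2) * A z))) =
        Re (\<mu> * (LINT z|circle. complex_of_real ((cmod (poly q z))\<^sup>2) * A z))"
      by (subst integral_Re) (use qA_int in simp_all)
    have "(LINT z|circle. (cmod (poly q z))\<^sup>2 * \<psi> \<mu> z) =
        (LINT z|circle. (cmod (poly q z))\<^sup>2 * D z + 2 * Re (\<mu> * (complex_of_real ((cmod (poly q z))\<^sup>2) * A z))
          + (cmod \<mu>)\<^sup>2 * C * ((cmod (poly q z))\<^sup>2 * 1))"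
      by (rule Bochner_Integration.integral_cong) (simp_all add: \<psi>_def algebra_simps)
    also have "\<dots> = (LINT z|circle. (cmod (poly q z))\<^sup>2 * D z)
        + 2 * Re (\<mu> * (LINT z|circle. complex_of_real ((cmod (poly q z))\<^sup>2) * A z))
        + (cmod \<mu>)\<^sup>2 * C * (LINT z|circle. (cmod (poly q z))\<^sup>2 * 1)"
      unfolding Bochner_Integration.integral_add[OF Bochner_Integration.integrable_add[OF i1 i2] i3]
        Bochner_Integration.integral_add[OF i1 i2] Bochner_Integration.integral_mult_right_zero A_Re ..
    also have "\<dots> \<ge> 0"
      unfolding D_part A_part mult_1_right C_part
      using hankel_pairing_nonneg[OF nonneg hyper M N f, of "coeff q" b "Suc (degree q)" \<mu>]
      by (simp only: C_def mult_ac)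
    finally show "0 \<le> (LINT z|circle. (cmod (poly q z))\<^sup>2 * \<psi> \<mu> z)" .
  qed
  have "AE z in circle. \<forall>\<mu>. 0 \<le> \<psi> \<mu> z"
    by (rule AE_nonneg_separable_parameter[OF _ \<psi>]) (auto simp: \<psi>_def intro!: continuous_intros)
  then show "AE z in circle. 0 \<le> D z \<and> (cmod (E_op N R z))\<^sup>2 \<le> C * D z"
  proof eventually_elim
    case (elim z)
    have "0 \<le> C"
      unfolding C_def by (intro integral_nonneg_AE eventually_mono[OF nonneg]) simp
    then show ?case
      using pairing_nonneg_imp_cmod_square_le[of "D z" "A z" C] elim by (simp add: \<psi>_def A_def)
  qed
qed

theorem proposition1p13:
  fixes \<phi> :: "complex \<Rightarrow> real" and N :: nat
    and f :: "complex \<Rightarrow> complex" and b :: "nat \<Rightarrow> complex" and B0 :: "complex \<Rightarrow> complex"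
  assumes nonneg: "AE z in circle. \<phi> z \<ge> 0"
    and hyper: "hyper_positive 2 (\<lambda>z. complex_of_real (\<phi> z))"
    and nonzero: "\<not> (AE z in circle. \<phi> z = 0)"
    and N: "N \<ge> 1"
    and f: "f \<in> H2_0"
    and B0: "B0 = (\<lambda>z. \<Sum>n<N. b n * z ^ n)"
    and B0_nonzero: "\<exists>z\<in>sphere 0 1. B0 z \<noteq> 0"
  shows "esssup circle (\<lambda>z.
            ereal (cmod (E_op N (hankel (\<lambda>z. complex_of_real (\<phi> z)) (\<lambda>z. B0 z * f z)) z))
            / ereal (sqrt (E_op N (\<lambda>z. (cmod (B0 z))\<^sup>2 * \<phi> z) z)))
         \<le> ereal (weighted_L2_norm \<phi> f)"
  unfolding B0
proof (rule esssup_I)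
  define R where "R = hankel (\<lambda>z. complex_of_real (\<phi> z)) (\<lambda>z. (\<Sum>n<N. b n * z ^ n) * f z)"
  define D where "D = E_op N (\<lambda>z. (cmod (\<Sum>n<N. b n * z ^ n))\<^sup>2 * \<phi> z)"
  have "integrable circle \<phi>"
    using hyper by (simp add: hyper_positive_def complex_of_real_integrable_eq)
  moreover have "(\<lambda>z. (cmod (\<Sum>n<N. b n * z ^ n))\<^sup>2) \<in> borel_measurable circle"
    by (intro borel_measurable_circle_continuous continuous_intros)
  ultimately have "(\<lambda>z. (cmod (\<Sum>n<N. b n * z ^ n))\<^sup>2 * \<phi> z) \<in> borel_measurable circle"
    by (intro borel_measurable_times) auto
  note [measurable] = measurable_E_op[OF this, of N, folded D_def]
  note square_le = E_op_hankel_square_le[OF nonneg hyper N f, of b, folded R_def D_def]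
  have "R \<in> borel_measurable circle"
    using square_le(1) by (simp add: L2_def)
  note [measurable] = measurable_E_op[OF this, of N]
  show "(\<lambda>z. ereal (cmod (E_op N (hankel (\<lambda>z. complex_of_real (\<phi> z)) (\<lambda>z. (\<Sum>n<N. b n * z ^ n) * f z)) z)) /
      ereal (sqrt (E_op N (\<lambda>z. (cmod (\<Sum>n<N. b n * z ^ n))\<^sup>2 * \<phi> z) z))) \<in> borel_measurable circle"
    unfolding R_def[symmetric] D_def[symmetric] by measurable
  show "AE z in circle. ereal (cmod (E_op N (hankel (\<lambda>z. complex_of_real (\<phi> z)) (\<lambda>z. (\<Sum>n<N. b n * z ^ n) * f z)) z)) /
      ereal (sqrt (E_op N (\<lambda>z. (cmod (\<Sum>n<N. b n * z ^ n))\<^sup>2 * \<phi> z) z)) \<le> ereal (weighted_L2_norm \<phi> f)"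
    unfolding R_def[symmetric] D_def[symmetric] using square_le(2)
  proof eventually_elim
    case (elim z)
    define C where "C = (LINT z|circle. (cmod (f z))\<^sup>2 * \<phi> z)"
    have C: "weighted_L2_norm \<phi> f = sqrt C"
      by (simp add: weighted_L2_norm_def C_def)
    have "cmod (E_op N R z) \<le> sqrt (C * D z)"
      using elim by (intro real_le_rsqrt) (simp add: C_def)
    then have le: "cmod (E_op N R z) \<le> sqrt C * sqrt (D z)"
      by (simp add: real_sqrt_mult)
    show ?case
    \<comment> \<open>Where \<open>D\<close> vanishes so does the numerator, and the quotient \<open>0 / 0\<close> has the value \<open>0\<close>.\<close>
    proof (cases "D z = 0")
      case True
      have "0 \<le> C"
        unfolding C_def by (intro integral_nonneg_AE eventually_mono[OF nonneg]) simp
      then show ?thesis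
        using True le by (simp add: C zero_ereal_def[symmetric])
    next
      case False
      then show ?thesis
        using elim le by (simp add: C divide_le_eq)
    qed
  qed
qed

end
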